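(* Let $(W,S)$ be a Coxeter system with a reflection order $<$, and let $u<v$ in the Bruhat order of $W$. Then the Coxeter Chow polynomial satisfies $$\mathrm{H}_{uv}(x)=\sum_{\Delta\in B(u,v)}x^{\frac{\rho_{uv}-\ell(\Delta)}{2}+\operatorname{asc}(\Delta)}=\sum_{\Delta\in B(u,v)}x^{\frac{\rho_{uv}-\ell(\Delta)}{2}+\operatorname{des}(\Delta)}.$$
   Context: $T=\{wsw^{-1}:w\in W,s\in S\}$ is the set of reflections, $\ell$ the Coxeter length, and $W$ carries the Bruhat order (graded, $\rho_{uv}=\ell(v)-\ell(u)$). The $R$-polynomials are defined for $u\le v$ by choosing $s\in S$ with $\ell(vs)<\ell(v)$ and setting $R_{uu}=1$, $R_{uv}=R_{us,vs}$ if $\ell(us)<\ell(u)$, and $R_{uv}=xR_{us,vs}+(x-1)R_{u,vs}$ otherwise (with $R_{uv}=0$ if $u\not\le v$). The element $R$ of the incidence algebra of the Bruhat order (maps $[u,v]\mapsto a_{uv}(x)\in\mathbb{Z}[x]$, product $(ab)_{uv}=\sum_{u\le w\le v}a_{uw}b_{wv}$) satisfies $R_{uu}=1$ and $R^{-1}=R^{\mathrm{rev}}$, where $a^{\mathrm{rev}}_{uv}(x)=x^{\rho_{uv}}a_{uv}(x^{-1})$. For $u<v$, $R_{uv}$ is divisible by $x-1$; let $\overline{R}_{uv}=R_{uv}/(x-1)$ for $u<v$ and $\overline{R}_{uu}=-1$. The Coxeter Chow function is $\mathrm{H}=-(\overline{R})^{-1}$. The Bruhat graph has vertex set $W$ and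 a directed edge $a\to b$ whenever $a^{-1}b\in T$ and $\ell(a)<\ell(b)$; $B(u,v)$ is the set of directed paths $\Delta=(a_0=u,a_1,\dots,a_r=v)$ in it, of length $\ell(\Delta)=r$. A reflection order is a total order on $T$ (identified with the positive roots $\Phi^+$) such that whenever $\alpha,\beta\in\Phi^+$, $\lambda,\mu>0$ and $\lambda\alpha+\mu\beta\in\Phi^+$, the root $\lambda\alpha+\mu\beta$ lies strictly between $\alpha$ and $\beta$. For a path $\Delta$, $i\in\{1,\dots,r-1\}$ is a descent if $a_{i-1}^{-1}a_i>a_i^{-1}a_{i+1}$; $\operatorname{des}(\Delta)$ is the number of descents and $\operatorname{asc}(\Delta)=\ell(\Delta)-\operatorname{des}(\Delta)-1$. *)

theory Defs
  imports
    "HOL-Algebra.Generated_Groups"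
    "HOL-Algebra.Multiplicative_Group"
    "HOL-Computational_Algebra.Polynomial"
    "HOL.Transcendental"
begin

definition word_prod :: "('a, 'b) monoid_scheme \<Rightarrow> 'a list \<Rightarrow> 'a" where
  "word_prod W ws = foldr (\<lambda>s w. s \<otimes>\<^bsub>W\<^esub> w) ws \<one>\<^bsub>W\<^esub>"

text \<open>
  Deletion of one defining relator \<open>(st)\<^sup>m\<close>, where \<open>m\<close> is the order of \<open>st\<close>, from a word in \<open>S\<close>.
  The library sets \<open>ord x = 0\<close> if \<open>x\<close> has infinite order, and then there is no relator. The case
  \<open>s = t\<close> has \<open>m = 1\<close> and gives the relator \<open>ss\<close>; because of it, formal inverses of letters are
  not needed.
\<close>

inductive (in group) relator_step :: "'a set \<Rightarrow> 'a list \<Rightarrow> 'a list \<Rightarrow> bool" for S where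
  "\<lbrakk>xs \<in> lists S; ys \<in> lists S; s \<in> S; t \<in> S; ord (s \<otimes> t) \<noteq> 0\<rbrakk> \<Longrightarrow>
    relator_step S (xs @ concat (replicate (ord (s \<otimes> t)) [s, t]) @ ys) (xs @ ys)"

text \<open>
  The group \<open>W\<close> is generated by the set \<open>S\<close> (possibly infinite) of involutions, and it is presented
  by the relations \<open>(st)\<^bsup>ord(st)\<^esup> = 1\<close>: words with the same product are related by insertions and
  deletions of relators.
\<close>

locale coxeter_system = group W for W (structure) + fixes S
  assumes generators_closed: "S \<subseteq> carrier W"
    and generate_eq: "generate W S = carrier W"
    and generators_involutive: "\<And>s. s \<in> S \<Longrightarrow> ord s = 2"
    and presentation: "\<And>xs ys. \<lbrakk>xs \<in> lists S; ys \<in> lists S; word_prod W xs = word_prod W ys\<rbrakk>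
      \<Longrightarrow> equivclp (relator_step S) xs ys"
begin

definition reflections :: "'a set" where
  "reflections = {w \<otimes> s \<otimes> inv w | w s. w \<in> carrier W \<and> s \<in> S}"

definition len :: "'a \<Rightarrow> nat" where
  "len w = (LEAST n. \<exists>ws \<in> lists S. length ws = n \<and> word_prod W ws = w)"


subsection \<open>Bruhat graph and Bruhat order\<close>

definition bruhat_edge :: "'a \<Rightarrow> 'a \<Rightarrow> bool" where
  "bruhat_edge a b \<longleftrightarrow>
    a \<in> carrier W \<and> b \<in> carrier W \<and> inv a \<otimes> b \<in> reflections \<and> len a < len b"

definition bruhat_le :: "'a \<Rightarrow> 'a \<Rightarrow> bool" where
  "bruhat_le u v \<longleftrightarrow> u \<in> carrier W \<and> bruhat_edge\<^sup>*\<^sup>* u v"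

definition bruhat_less :: "'a \<Rightarrow> 'a \<Rightarrow> bool" where
  "bruhat_less u v \<longleftrightarrow> bruhat_le u v \<and> u \<noteq> v"

definition rank_diff :: "'a \<Rightarrow> 'a \<Rightarrow> nat" where
  "rank_diff u v = len v - len u"

text \<open>A path \<open>(a\<^sub>0, \<dots>, a\<^sub>r)\<close> is represented by its list of \<open>r + 1\<close> vertices.\<close>

definition bruhat_paths :: "'a \<Rightarrow> 'a \<Rightarrow> 'a list set" where
  "bruhat_paths u v = {p. p \<noteq> [] \<and> set p \<subseteq> carrier W \<and> hd p = u \<and> last p = v \<and>
    successively bruhat_edge p}"

definition path_length :: "'a list \<Rightarrow> nat" where
  "path_length p = length p - 1"


subsection \<open>Roots and reflection orders\<close>

text \<open>
  The geometric representation on the real vector space with basis \<open>S\<close>; its vectors are represented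
  as finitely supported functions.
\<close>

definition simple_root :: "'a \<Rightarrow> 'a \<Rightarrow> real" where
  "simple_root s = (\<lambda>t. if t = s then 1 else 0)"

definition coxeter_form :: "('a \<Rightarrow> real) \<Rightarrow> ('a \<Rightarrow> real) \<Rightarrow> real" where
  "coxeter_form x y = (\<Sum>s | x s \<noteq> 0. \<Sum>t | y t \<noteq> 0. x s * y t *
    (if ord (s \<otimes> t) = 0 then -1 else - cos (pi / real (ord (s \<otimes> t)))))"

definition simple_reflection :: "'a \<Rightarrow> ('a \<Rightarrow> real) \<Rightarrow> 'a \<Rightarrow> real" where
  "simple_reflection s x = (\<lambda>t. x t - 2 * coxeter_form x (simple_root s) * simple_root s t)"

definition word_action :: "'a list \<Rightarrow> ('a \<Rightarrow> real) \<Rightarrow> 'a \<Rightarrow> real" where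
  "word_action ws = foldr simple_reflection ws"

definition roots :: "('a \<Rightarrow> real) set" where
  "roots = {word_action ws (simple_root s) | ws s. ws \<in> lists S \<and> s \<in> S}"

definition positive_roots :: "('a \<Rightarrow> real) set" where
  "positive_roots = {\<beta> \<in> roots. \<forall>s. 0 \<le> \<beta> s}"

text \<open>The identification of positive roots with reflections: \<open>w \<alpha>\<^sub>s\<close> corresponds to \<open>w s w\<^sup>-\<^sup>1\<close>.\<close>

definition root_reflection :: "('a \<Rightarrow> real) \<Rightarrow> 'a" where
  "root_reflection \<beta> = (THE t. \<exists>ws \<in> lists S. \<exists>s \<in> S. \<beta> = word_action ws (simple_root s) \<and>
    t = word_prod W ws \<otimes> s \<otimes> inv (word_prod W ws))"

text \<open>
  A reflection order is given as a strict total order \<open>r\<close> on the set of reflections. The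
  condition concerns distinct \<open>\<alpha>\<close> and \<open>\<beta>\<close>: for \<open>\<alpha> = \<beta>\<close>, no root lies strictly between them.
\<close>

definition reflection_order :: "('a \<times> 'a) set \<Rightarrow> bool" where
  "reflection_order r \<longleftrightarrow>
    r \<subseteq> reflections \<times> reflections \<and> strict_linear_order_on reflections r \<and>
    (\<forall>\<alpha> \<in> positive_roots. \<forall>\<beta> \<in> positive_roots. \<forall>l m :: real.
      \<alpha> \<noteq> \<beta> \<and> 0 < l \<and> 0 < m \<and> (\<lambda>t. l * \<alpha> t + m * \<beta> t) \<in> positive_roots \<longrightarrow>
      (let a = root_reflection \<alpha>; b = root_reflection \<beta>;
           c = root_reflection (\<lambda>t. l * \<alpha> t + m * \<beta> t)
       in (a, c) \<in> r \<and> (c, b) \<in> r \<or> (b, c) \<in> r \<and> (c, a) \<in> r))"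

definition des :: "('a \<times> 'a) set \<Rightarrow> 'a list \<Rightarrow> nat" where
  "des r p = card {i \<in> {1..<path_length p}.
    (inv (p ! i) \<otimes> p ! (i + 1), inv (p ! (i - 1)) \<otimes> p ! i) \<in> r}"

definition asc :: "('a \<times> 'a) set \<Rightarrow> 'a list \<Rightarrow> nat" where
  "asc r p = path_length p - des r p - 1"


subsection \<open>Words and lengths\<close>

lemma word_prod_Nil [simp]: "word_prod W [] = \<one>"
  and word_prod_Cons [simp]: "word_prod W (x # xs) = x \<otimes> word_prod W xs"
  by (simp_all add: word_prod_def)

lemma word_prod_closed [simp, intro]: "xs \<in> lists S \<Longrightarrow> word_prod W xs \<in> carrier W"
  using generators_closed by (induction xs) auto

lemma word_prod_append:
  "xs \<in> lists S \<Longrightarrow> ys \<in> lists S \<Longrightarrow> word_prod W (xs @ ys) = word_prod W xs \<otimes> word_prod W ys"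
proof (induction xs)
  case (Cons x xs)
  then show ?case using generators_closed by (auto simp: m_assoc subset_iff)
qed auto

lemma generator_square: "s \<in> S \<Longrightarrow> s \<otimes> s = \<one>"
  using pow_ord_eq_1[of s] generators_closed generators_involutive[of s]
  by (auto simp: numeral_2_eq_2)

lemma generator_inv: "s \<in> S \<Longrightarrow> inv s = s"
  using generator_square generators_closed by (intro inv_equality) auto

lemma word_prod_rev: "xs \<in> lists S \<Longrightarrow> word_prod W (rev xs) = inv (word_prod W xs)"
proof (induction xs)
  case (Cons x xs)
  then have "x \<in> carrier W" "x \<in> S" "xs \<in> lists S" using generators_closed by auto
  with Cons show ?case
    by (simp add: word_prod_append inv_mult_group generator_inv in_lists_conv_set)
qed auto

lemma ex_word:
  assumes "w \<in> carrier W"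
  shows "\<exists>ws \<in> lists S. word_prod W ws = w"
proof -
  have "w \<in> generate W S" using assms generate_eq by simp
  then show ?thesis
  proof (induction rule: generate.induct)
    case one
    show ?case by (rule bexI[of _ "[]"]) auto
  next
    case (incl h)
    with generators_closed show ?case by (intro bexI[of _ "[h]"]) auto
  next
    case (inv h)
    with generators_closed show ?case by (intro bexI[of _ "[h]"]) (auto simp: generator_inv)
  next
    case (eng g h)
    then obtain xs ys where "xs \<in> lists S" "word_prod W xs = g" "ys \<in> lists S" "word_prod W ys = h"
      by blast
    then show ?case by (intro bexI[of _ "xs @ ys"]) (auto simp: word_prod_append)
  qed
qed

lemma ex_reduced_word:
  assumes "w \<in> carrier W"
  shows "\<exists>ws \<in> lists S. length ws = len w \<and> word_prod W ws = w"
proof -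
  have "\<exists>n. \<exists>ws \<in> lists S. length ws = n \<and> word_prod W ws = w"
    using ex_word[OF assms] by blast
  then show ?thesis unfolding len_def by (rule LeastI_ex)
qed

lemma len_word_le: "ws \<in> lists S \<Longrightarrow> len (word_prod W ws) \<le> length ws"
  unfolding len_def by (rule Least_le) auto

lemma word_parity:
  assumes "xs \<in> lists S" "ys \<in> lists S" "word_prod W xs = word_prod W ys"
  shows "even (length xs) = even (length ys)"
proof -
  have step: "even (length as) = even (length bs)" if "relator_step S as bs" for as bs
    using that by cases (auto simp: length_concat sum_list_replicate)
  have "equivclp (relator_step S) xs ys" using presentation assms by blast
  then show ?thesis
    by (induction rule: equivclp_induct) (use step in auto)
qed

lemma bruhat_edge_parity:
  assumes "bruhat_edge a b"
  shows "even (len b) = odd (len a)"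
proof -
  have ab: "a \<in> carrier W" "b \<in> carrier W" "inv a \<otimes> b \<in> reflections"
    using assms by (auto simp: bruhat_edge_def)
  then obtain w s where w: "w \<in> carrier W" "s \<in> S" "inv a \<otimes> b = w \<otimes> s \<otimes> inv w"
    unfolding reflections_def by blast
  obtain as where as: "as \<in> lists S" "length as = len a" "word_prod W as = a"
    using ex_reduced_word ab by blast
  obtain bs where bs: "bs \<in> lists S" "length bs = len b" "word_prod W bs = b"
    using ex_reduced_word ab by blast
  obtain ws where ws: "ws \<in> lists S" "word_prod W ws = w" using ex_word w by blast
  have s: "s \<in> carrier W" using w generators_closed by blast
  have "b = a \<otimes> (inv a \<otimes> b)" using ab by (simp add: m_assoc[symmetric])
  also have "\<dots> = word_prod W (as @ ws @ [s] @ rev ws)"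
    using as ws w s by (simp add: word_prod_append word_prod_rev m_assoc in_lists_conv_set)
  finally have "even (length bs) = even (length (as @ ws @ [s] @ rev ws))"
    using bs as ws w by (intro word_parity) auto
  then show ?thesis using as bs by simp
qed

text \<open>
  Hence the exponents \<open>(\<rho>\<^sub>u\<^sub>v - \<ell>(\<Delta>)) / 2\<close> are natural numbers, and truncated subtraction and
  division on \<open>nat\<close> compute them.
\<close>

lemma bruhat_path_length:
  assumes "p \<in> bruhat_paths u v"
  shows "path_length p \<le> rank_diff u v" and "even (rank_diff u v - path_length p)"
proof -
  have "len (hd p) + path_length p \<le> len (last p) \<and>
      even (len (last p) + len (hd p) + path_length p)"
    if "p \<noteq> []" "successively bruhat_edge p" for p
    using that
  proof (induction p rule: induct_list012)
    case (3 x y zs)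
    then have "len x < len y" "even (len y) = odd (len x)"
      using bruhat_edge_parity by (auto simp: bruhat_edge_def)
    with 3 show ?case by (auto simp: path_length_def)
  qed (auto simp: path_length_def)
  with assms have *: "len u + path_length p \<le> len v" "even (len v + len u + path_length p)"
    by (auto simp: bruhat_paths_def)
  then show "path_length p \<le> rank_diff u v" by (simp add: rank_diff_def)
  from * show "even (rank_diff u v - path_length p)" by (auto simp: rank_diff_def)
qed

lemma bruhat_edges_len: "bruhat_edge\<^sup>*\<^sup>* u v \<Longrightarrow> u = v \<or> v \<in> carrier W \<and> len u < len v"
  by (induction rule: rtranclp_induct) (auto simp: bruhat_edge_def)

lemma ex_right_descent:
  assumes "v \<in> carrier W" "0 < len v"
  shows "\<exists>s. s \<in> S \<and> len (v \<otimes> s) < len v"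
proof -
  obtain ws where ws: "ws \<in> lists S" "length ws = len v" "word_prod W ws = v"
    using ex_reduced_word assms by blast
  with assms have "ws \<noteq> []" by auto
  then obtain xs s where xs: "ws = xs @ [s]" by (metis rev_exhaust)
  with ws have S: "xs \<in> lists S" "s \<in> S" by auto
  then have "v = word_prod W xs \<otimes> s"
    using ws xs generators_closed by (auto simp: word_prod_append)
  then have "v \<otimes> s = word_prod W xs"
    using S generators_closed by (simp add: m_assoc generator_square subset_iff)
  then show ?thesis using len_word_le[OF S(1)] ws xs S by auto
qed

definition right_descent :: "'a \<Rightarrow> 'a" where
  "right_descent v = (SOME s. s \<in> S \<and> len (v \<otimes> s) < len v)"

lemma right_descent:
  assumes "bruhat_le u v" "u \<noteq> v"
  shows "right_descent v \<in> S" and "len (v \<otimes> right_descent v) < len v"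
proof -
  have "v \<in> carrier W" "0 < len v"
    using assms bruhat_edges_len by (fastforce simp: bruhat_le_def)+
  from someI_ex[OF ex_right_descent[OF this]]
  show "right_descent v \<in> S" "len (v \<otimes> right_descent v) < len v"
    unfolding right_descent_def by blast+
qed


subsection \<open>R-polynomials and the Coxeter Chow function\<close>

function R_poly :: "'a \<Rightarrow> 'a \<Rightarrow> int poly" where
  "R_poly u v =
    (if \<not> bruhat_le u v then 0
     else if u = v then 1
     else if len (u \<otimes> right_descent v) < len u
       then R_poly (u \<otimes> right_descent v) (v \<otimes> right_descent v)
     else [:0, 1:] * R_poly (u \<otimes> right_descent v) (v \<otimes> right_descent v)
        + [:-1, 1:] * R_poly u (v \<otimes> right_descent v))"
  by auto
termination
  by (relation "measure (\<lambda>(u, v). len v)") (auto dest: right_descent(2))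

declare R_poly.simps [simp del]

definition R_bar :: "'a \<Rightarrow> 'a \<Rightarrow> int poly" where
  "R_bar u v =
    (if bruhat_less u v then R_poly u v div [:-1, 1:] else if bruhat_le u v then -1 else 0)"

text \<open>Functions on intervals \<open>[u, v]\<close> are extended by \<open>0\<close> to the pairs with \<open>u \<not>\<le> v\<close>.\<close>

definition incidence_algebra :: "('a \<Rightarrow> 'a \<Rightarrow> int poly) ring" where
  "incidence_algebra =
    \<lparr>carrier = {a. \<forall>u v. \<not> bruhat_le u v \<longrightarrow> a u v = 0},
     monoid.mult = (\<lambda>a b u v. \<Sum>w | bruhat_le u w \<and> bruhat_le w v. a u w * b w v),
     one = (\<lambda>u v. if bruhat_le u v \<and> u = v then 1 else 0),
     zero = (\<lambda>u v. 0),
     add = (\<lambda>a b u v. a u v + b u v)\<rparr>"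

definition coxeter_chow :: "'a \<Rightarrow> 'a \<Rightarrow> int poly" where
  "coxeter_chow = \<ominus>\<^bsub>incidence_algebra\<^esub> (inv\<^bsub>incidence_algebra\<^esub> R_bar)"

end

end

theory Submission
  imports Defs
begin

text \<open>
  Expanding \<open>-(R_bar)\<^sup>-\<^sup>1\<close> as a geometric series turns Dyer's formula, which writes
  \<open>R\<^sub>u\<^sub>v\<close> as the sum of \<open>x\<^bsup>(\<rho> - \<ell>) / 2\<^esup> (x - 1)\<^sup>\<ell>\<close> over the increasing paths from \<open>u\<close> to \<open>v\<close>, into a
  sum over all paths cut into increasing pieces. Every descent must be cut, and an ascent contributes
  \<open>1\<close> if it is cut and \<open>x - 1\<close> if not, so each path gets \<open>x\<close> to the number of its ascents. The
  converse of a reflection order is a reflection order, which gives the formula with descents.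

  Dyer's formula is proved for an arbitrary reflection order and an arbitrary Coxeter group as follows.
  Left multiplication by a generator \<open>s\<close> preserves the labels \<open>a\<^sup>-\<^sup>1b\<close> of the Bruhat graph and the
  orientation of all edges except \<open>a \<rightarrow> sa\<close>. Such an edge has label \<open>a\<^sup>-\<^sup>1sa\<close>, and a sign rule tells how the
  position of this label relative to those of an increasing path through \<open>a\<close> evolves along the path.
  It follows that the generating function of the increasing paths satisfies the left-handed
  version of the recursion for the \<open>R\<close>-polynomials. Left and right operators commute,
  so it satisfies the right-handed version as well.
\<close>

section \<open>The geometric representation\<close>

context coxeter_system
begin

text \<open>A Coxeter system is given here by a presentation only. Positivity of roots, faithfulness
  of the geometric representation and strong exchange are therefore derived from it before any path
  is considered; without faithfulness the identification of roots with reflections would not even be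
  well defined. Left multiplication suits the labels \<open>inv a \<otimes> b\<close>, whereas
  \<open>R_poly\<close> descends along right descents. This mismatch is why a left-handed recursion
  has to be converted into a right-handed one. The reflection order stays fixed throughout: instead
  of being transformed by a generator, it is cut into initial sections, over all of which the left
  recursion is proved simultaneously. Path generating functions live in the variable q = x^(1/2) -
  x^(-1/2). The half-integral powers never appear, because rank differences and path lengths have
  equal parity. The path expansion shows only that minus the path sum is a left inverse of
  \<open>R_bar\<close>, while the inverse in the definition is two-sided. A one-sided inverse in a
  triangular situation is supplied separately to close this gap.\<close>

declare in_lists_conv_set [simp del] and in_listsD [rule del]

lemma rev_in_lists [simp]: "rev xs \<in> lists A \<longleftrightarrow> xs \<in> lists A"
  by (simp add: in_lists_conv_set)

lemma concat_replicate_in_lists [simp, intro]: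
  "xs \<in> lists A \<Longrightarrow> concat (replicate n xs) \<in> lists A"
  by (induction n) auto

text \<open>A sum over an infinite support would be 0, so \<open>coxeter_form\<close> is bilinear
  only on finitely supported functions. The functions are indexed by all elements of the type, and
  symmetry of the form requires supports inside S.\<close>

definition vecs :: "('a \<Rightarrow> real) set" where
  "vecs = {x. finite {s. x s \<noteq> 0} \<and> {s. x s \<noteq> 0} \<subseteq> S}"

definition gram :: "'a \<Rightarrow> 'a \<Rightarrow> real" where
  "gram s t = (if ord (s \<otimes> t) = 0 then -1 else - cos (pi / real (ord (s \<otimes> t))))"

lemma form_superset:
  assumes "finite F" "finite G" "{s. x s \<noteq> 0} \<subseteq> F" "{t. y t \<noteq> 0} \<subseteq> G"
  shows "coxeter_form x y = (\<Sum>s\<in>F. \<Sum>t\<in>G. x s * y t * gram s t)"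
proof -
  have "(\<Sum>s\<in>F. \<Sum>t\<in>G. x s * y t * gram s t) = (\<Sum>s\<in>F. \<Sum>t | y t \<noteq> 0. x s * y t * gram s t)"
    using assms by (intro sum.cong refl sum.mono_neutral_right) auto
  also have "\<dots> = (\<Sum>s | x s \<noteq> 0. \<Sum>t | y t \<noteq> 0. x s * y t * gram s t)"
    using assms by (intro sum.mono_neutral_right) auto
  finally show ?thesis by (simp add: coxeter_form_def gram_def)
qed

lemma generator_carrier [simp, intro]: "s \<in> S \<Longrightarrow> s \<in> carrier W"
  using generators_closed by blast

lemma ord_generators_commute:
  assumes "s \<in> S" "t \<in> S"
  shows "ord (t \<otimes> s) = ord (s \<otimes> t)"
proof -
  have "inv (s \<otimes> t) = t \<otimes> s" using assms by (simp add: inv_mult_group generator_inv)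
  then show ?thesis using assms ord_inv[of "s \<otimes> t"] by simp
qed

lemma gram_commute: "s \<in> S \<Longrightarrow> t \<in> S \<Longrightarrow> gram s t = gram t s"
  by (simp add: gram_def ord_generators_commute)

lemma gram_self: "s \<in> S \<Longrightarrow> gram s s = 1"
  by (simp add: gram_def generator_square)

lemma form_commute:
  assumes "x \<in> vecs" "y \<in> vecs"
  shows "coxeter_form x y = coxeter_form y x"
proof -
  let ?F = "{s. x s \<noteq> 0}" and ?G = "{s. y s \<noteq> 0}"
  have fin: "finite ?F" "finite ?G" "?F \<subseteq> S" "?G \<subseteq> S" using assms by (auto simp: vecs_def)
  have "coxeter_form x y = (\<Sum>s\<in>?F. \<Sum>t\<in>?G. x s * y t * gram s t)"
    using fin by (intro form_superset) auto
  also have "\<dots> = (\<Sum>t\<in>?G. \<Sum>s\<in>?F. y t * x s * gram t s)"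
    using fin gram_commute by (subst sum.swap) (intro sum.cong refl, auto simp: subset_iff)
  also have "\<dots> = coxeter_form y x"
    using fin by (intro form_superset[symmetric]) auto
  finally show ?thesis .
qed

lemma vecs_lin [intro]:
  assumes "x \<in> vecs" "y \<in> vecs"
  shows "(\<lambda>t. a * x t + b * y t) \<in> vecs"
proof -
  have "{s. a * x s + b * y s \<noteq> 0} \<subseteq> {s. x s \<noteq> 0} \<union> {s. y s \<noteq> 0}" by auto
  with assms show ?thesis unfolding vecs_def by (auto intro: finite_subset)
qed

lemma form_lin_left:
  assumes "x \<in> vecs" "y \<in> vecs" "z \<in> vecs"
  shows "coxeter_form (\<lambda>t. a * x t + b * y t) z = a * coxeter_form x z + b * coxeter_form y z"
proof -
  let ?F = "{s. x s \<noteq> 0} \<union> {s. y s \<noteq> 0}" and ?G = "{s. z s \<noteq> 0}"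
  have fin: "finite ?F" "finite ?G" using assms by (auto simp: vecs_def)
  have "coxeter_form (\<lambda>t. a * x t + b * y t) z
      = (\<Sum>s\<in>?F. \<Sum>t\<in>?G. (a * x s + b * y s) * z t * gram s t)"
    using fin by (intro form_superset) auto
  also have "\<dots> = a * (\<Sum>s\<in>?F. \<Sum>t\<in>?G. x s * z t * gram s t)
      + b * (\<Sum>s\<in>?F. \<Sum>t\<in>?G. y s * z t * gram s t)"
    by (simp add: sum_distrib_left sum.distrib algebra_simps)
  also have "(\<Sum>s\<in>?F. \<Sum>t\<in>?G. x s * z t * gram s t) = coxeter_form x z"
    using fin by (intro form_superset[symmetric]) auto
  also have "(\<Sum>s\<in>?F. \<Sum>t\<in>?G. y s * z t * gram s t) = coxeter_form y z"
    using fin by (intro form_superset[symmetric]) auto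
  finally show ?thesis .
qed

lemma form_lin_right:
  assumes "x \<in> vecs" "y \<in> vecs" "z \<in> vecs"
  shows "coxeter_form z (\<lambda>t. a * x t + b * y t) = a * coxeter_form z x + b * coxeter_form z y"
  using assms form_lin_left[OF assms] by (simp add: form_commute[of z] vecs_lin)

lemma simple_root_vecs [simp, intro]: "s \<in> S \<Longrightarrow> simple_root s \<in> vecs"
  by (auto simp: vecs_def simple_root_def)

lemma form_simple_roots: "coxeter_form (simple_root s) (simple_root t) = gram s t"
  by (subst form_superset[of "{s}" "{t}"]) (auto simp: simple_root_def)

text \<open>The coefficient 1 is kept so that the right-hand side is literally of the shape to which
  the linearity lemmas apply.\<close>

lemma simple_reflection_lin_form:
  "simple_reflection s x = (\<lambda>t. 1 * x t + (- 2 * coxeter_form x (simple_root s)) * simple_root s t)"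
  by (simp add: simple_reflection_def)

lemma simple_reflection_vecs [simp, intro]: "s \<in> S \<Longrightarrow> x \<in> vecs \<Longrightarrow> simple_reflection s x \<in> vecs"
  unfolding simple_reflection_lin_form by (intro vecs_lin) auto

lemma simple_reflection_lin:
  assumes "s \<in> S" "x \<in> vecs" "y \<in> vecs"
  shows "simple_reflection s (\<lambda>t. a * x t + b * y t) =
    (\<lambda>t. a * simple_reflection s x t + b * simple_reflection s y t)"
  using assms by (auto simp: simple_reflection_def form_lin_left algebra_simps)

lemma form_simple_reflection_root:
  assumes "s \<in> S" "x \<in> vecs"
  shows "coxeter_form (simple_reflection s x) (simple_root s) = - coxeter_form x (simple_root s)"
  unfolding simple_reflection_lin_form using assms
  by (subst form_lin_left) (auto simp: form_simple_roots gram_self)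

lemma simple_reflection_involutive:
  assumes "s \<in> S" "x \<in> vecs"
  shows "simple_reflection s (simple_reflection s x) = x"
proof -
  have "simple_reflection s (simple_reflection s x) = (\<lambda>t. simple_reflection s x t
      - 2 * coxeter_form (simple_reflection s x) (simple_root s) * simple_root s t)"
    by (simp only: simple_reflection_def[of s "simple_reflection s x"])
  then show ?thesis
    by (simp add: form_simple_reflection_root[OF assms]) (simp add: simple_reflection_def)
qed

lemma form_simple_reflection:
  assumes "s \<in> S" "x \<in> vecs" "y \<in> vecs"
  shows "coxeter_form (simple_reflection s x) (simple_reflection s y) = coxeter_form x y"
proof -
  have "coxeter_form (simple_reflection s x) (simple_reflection s y)
     = coxeter_form (simple_reflection s x) y
       - 2 * coxeter_form y (simple_root s) * coxeter_form (simple_reflection s x) (simple_root s)"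
    unfolding simple_reflection_lin_form[of s y] using assms by (subst form_lin_right) auto
  also have "coxeter_form (simple_reflection s x) y
     = coxeter_form x y - 2 * coxeter_form x (simple_root s) * coxeter_form (simple_root s) y"
    unfolding simple_reflection_lin_form[of s x] using assms by (subst form_lin_left) auto
  finally show ?thesis
    using assms by (simp add: form_simple_reflection_root form_commute[of y])
qed

lemma word_action_Nil [simp]: "word_action [] x = x"
  and word_action_Cons [simp]: "word_action (s # ws) x = simple_reflection s (word_action ws x)"
  and word_action_append: "word_action (ws @ ws') x = word_action ws (word_action ws' x)"
  by (simp_all add: word_action_def)

lemma word_action_vecs [simp, intro]: "ws \<in> lists S \<Longrightarrow> x \<in> vecs \<Longrightarrow> word_action ws x \<in> vecs"
  by (induction ws) auto

lemma word_action_lin: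
  assumes "ws \<in> lists S" "x \<in> vecs" "y \<in> vecs"
  shows "word_action ws (\<lambda>t. a * x t + b * y t) =
    (\<lambda>t. a * word_action ws x t + b * word_action ws y t)"
  using assms(1) by (induction ws) (use assms in \<open>auto simp: simple_reflection_lin\<close>)

lemma form_word_action:
  assumes "ws \<in> lists S" "x \<in> vecs" "y \<in> vecs"
  shows "coxeter_form (word_action ws x) (word_action ws y) = coxeter_form x y"
  using assms(1) by (induction ws) (use assms in \<open>auto simp: form_simple_reflection\<close>)

lemma word_action_rev:
  assumes "ws \<in> lists S" "x \<in> vecs"
  shows "word_action (rev ws) (word_action ws x) = x"
  using assms(1)
  by (induction ws) (use assms in \<open>auto simp: word_action_append simple_reflection_involutive\<close>)

lemma word_action_fixed:
  assumes "set ws \<subseteq> {s. coxeter_form x (simple_root s) = 0}"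
  shows "word_action ws x = x"
  using assms by (induction ws) (auto simp: simple_reflection_def)

text \<open>The alternating word in \<open>s\<close> and \<open>t\<close> of length \<open>k\<close> whose last letter is \<open>t\<close>.\<close>

fun alt :: "'a \<Rightarrow> 'a \<Rightarrow> nat \<Rightarrow> 'a list" where
  "alt s t 0 = []"
| "alt s t (Suc k) = (if even k then t else s) # alt s t k"

text \<open>The Chebyshev sequence \<open>sin (k \<theta>) / sin \<theta>\<close>, where \<open>c = cos \<theta>\<close>.\<close>

fun cheb :: "real \<Rightarrow> nat \<Rightarrow> real" where
  "cheb c 0 = 0"
| "cheb c (Suc 0) = 1"
| "cheb c (Suc (Suc k)) = 2 * c * cheb c (Suc k) - cheb c k"

text \<open>Adding the formulas for sin ((k+1)\<theta> + \<theta>) and sin ((k+1)\<theta> -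
  \<theta>) gives the recursion of \<open>cheb\<close>.\<close>

lemma cheb_cos: "sin \<theta> * cheb (cos \<theta>) k = sin (real k * \<theta>)"
proof (induction "cos \<theta>" k rule: cheb.induct)
  case (3 k)
  have "sin (real (Suc (Suc k)) * \<theta>) + sin (real k * \<theta>) = 2 * cos \<theta> * sin (real (Suc k) * \<theta>)"
    using sin_add[of "real (Suc k) * \<theta>" \<theta>] sin_diff[of "real (Suc k) * \<theta>" \<theta>]
    by (simp add: algebra_simps)
  moreover have "sin \<theta> * cheb (cos \<theta>) (Suc (Suc k)) + sin \<theta> * cheb (cos \<theta>) k
      = 2 * cos \<theta> * (sin \<theta> * cheb (cos \<theta>) (Suc k))"
    by (simp add: algebra_simps)
  ultimately show ?case using 3 by simp
qed auto

text \<open>The limit \<theta> = 0, which describes a pair of generators whose product has infinite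
  order.\<close>

lemma cheb_one: "cheb 1 k = real k"
  by (induction "1::real" k rule: cheb.induct) auto

lemma alt_lists [simp, intro]: "s \<in> S \<Longrightarrow> t \<in> S \<Longrightarrow> alt s t k \<in> lists S"
  by (induction k) auto

lemma length_alt [simp]: "length (alt s t k) = k"
  by (induction k) auto

lemma alt_replicate: "alt s t (2 * k) = concat (replicate k [s, t])"
  by (induction k) auto

lemma alt_add: "\<exists>xs. set xs \<subseteq> {s, t} \<and> length xs = j \<and> alt s t (j + k) = xs @ alt s t k"
proof (induction j)
  case (Suc j)
  then obtain xs where "set xs \<subseteq> {s, t}" "length xs = j" "alt s t (j + k) = xs @ alt s t k" by blast
  then show ?case by (intro exI[of _ "(if even (j + k) then t else s) # xs"]) auto
qed simp

lemma alt_snoc: "alt s t (Suc k) = alt t s k @ [t]"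
  by (induction k) auto

text \<open>A simple reflection changes only the coefficient of its own root. Each further letter
  thus replaces the older of two consecutive Chebyshev values by the next one, which is why the
  coefficients change places with the parity of k.\<close>

lemma word_action_alt:
  assumes "s \<in> S" "t \<in> S"
  defines "c \<equiv> - gram s t"
  shows "word_action (alt s t k) (simple_root s) =
    (\<lambda>x. (if even k then cheb c (Suc k) else cheb c k) * simple_root s x
      + (if even k then cheb c k else cheb c (Suc k)) * simple_root t x)"
proof (induction k)
  case (Suc k)
  have g: "gram t s = - c" "gram s t = - c" "gram s s = 1" "gram t t = 1"
    using assms gram_commute gram_self by auto
  have step: "simple_reflection r (\<lambda>x. a * simple_root s x + b * simple_root t x) =
    (\<lambda>x. a * simple_root s x + b * simple_root t x
      - 2 * (a * gram s r + b * gram t r) * simple_root r x)" if "r \<in> S" for r a b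
    unfolding simple_reflection_def using assms(1,2) that
    by (simp add: form_lin_left form_simple_roots)
  show ?case
  proof (cases "even k")
    case True
    then have "word_action (alt s t (Suc k)) (simple_root s) = simple_reflection t
        (\<lambda>x. cheb c (Suc k) * simple_root s x + cheb c k * simple_root t x)"
      using Suc by simp
    also have "\<dots> = (\<lambda>x. cheb c (Suc k) * simple_root s x + cheb c (Suc (Suc k)) * simple_root t x)"
      using assms(2) by (subst step) (auto simp: g algebra_simps)
    finally show ?thesis using True by simp
  next
    case False
    then have "word_action (alt s t (Suc k)) (simple_root s) = simple_reflection s
        (\<lambda>x. cheb c k * simple_root s x + cheb c (Suc k) * simple_root t x)"
      using Suc by simp
    also have "\<dots> = (\<lambda>x. cheb c (Suc (Suc k)) * simple_root s x + cheb c (Suc k) * simple_root t x)"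
      using assms(1) by (subst step) (auto simp: g algebra_simps)
    finally show ?thesis using False by simp
  qed
qed auto

section \<open>Defining relators act trivially\<close>

lemma ord_neq_1:
  assumes "s \<in> S" "t \<in> S" "s \<noteq> t"
  shows "ord (s \<otimes> t) \<noteq> 1"
proof
  assume *: "ord (s \<otimes> t) = 1"
  have st: "s \<in> carrier W" "t \<in> carrier W" using assms generators_closed by auto
  then have "s \<otimes> t = \<one>" using * ord_eq_1[of "s \<otimes> t"] by auto
  then have "inv t = s" using st by (intro inv_equality) auto
  then show False using assms generator_inv by auto
qed

lemma sin_pi_div_pos: "2 \<le> (m::nat) \<Longrightarrow> 0 < sin (pi / real m)"
  by (intro sin_gt_zero) (auto simp: field_simps)

lemma cheb_gram_nonneg:
  assumes "s \<in> S" "t \<in> S" "s \<noteq> t" "ord (s \<otimes> t) = 0 \<or> k \<le> ord (s \<otimes> t)"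
  shows "0 \<le> cheb (- gram s t) k"
proof (cases "ord (s \<otimes> t) = 0")
  case True
  then show ?thesis by (simp add: gram_def cheb_one)
next
  case False
  define m where "m = ord (s \<otimes> t)"
  have m: "2 \<le> m" "k \<le> m" using False ord_neq_1[of s t] assms by (auto simp: m_def)
  have "0 \<le> sin (real k * (pi / real m))"
    using m by (intro sin_ge_zero) (auto simp: field_simps)
  then have "0 \<le> sin (pi / real m) * cheb (cos (pi / real m)) k" by (simp add: cheb_cos)
  then have "0 \<le> cheb (cos (pi / real m)) k"
    using sin_pi_div_pos[OF m(1)] by (simp add: zero_le_mult_iff)
  then show ?thesis using False by (simp add: gram_def m_def)
qed

text \<open>With \<theta> = pi / m, the coefficients after 2m letters are sin (2 pi) / sin \<theta>
  = 0 and sin (2 pi + \<theta>) / sin \<theta> = 1.\<close>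

lemma relator_fixes_root:
  assumes "s \<in> S" "t \<in> S" "s \<noteq> t" "ord (s \<otimes> t) \<noteq> 0"
  shows "word_action (alt s t (2 * ord (s \<otimes> t))) (simple_root s) = simple_root s"
proof -
  define m where "m = ord (s \<otimes> t)"
  have m: "2 \<le> m" using ord_neq_1[of s t] assms by (auto simp: m_def)
  have c: "- gram s t = cos (pi / real m)" using assms by (simp add: gram_def m_def)
  have "sin (pi / real m) * cheb (cos (pi / real m)) (2 * m) = 0"
    unfolding cheb_cos using m by simp
  moreover have "sin (pi / real m) * cheb (cos (pi / real m)) (Suc (2 * m)) = sin (pi / real m)"
    unfolding cheb_cos using m sin_periodic[of "pi / real m"] by (simp add: field_simps)
  ultimately have "cheb (cos (pi / real m)) (2 * m) = 0"
    "cheb (cos (pi / real m)) (Suc (2 * m)) = 1"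
    using sin_pi_div_pos[OF m] by auto
  then show ?thesis
    unfolding word_action_alt[OF assms(1,2)] c m_def[symmetric] by (simp del: cheb.simps)
qed

text \<open>For s different from t, the Gram determinant of the two simple roots is sin(pi / m)^2 >
  0. Hence x splits into a part in their plane, where the relator fixes both basis vectors, and a
  part orthogonal to both, which each letter fixes.\<close>

lemma relator_acts_trivially:
  assumes "s \<in> S" "t \<in> S" "ord (s \<otimes> t) \<noteq> 0" "x \<in> vecs"
  shows "word_action (concat (replicate (ord (s \<otimes> t)) [s, t])) x = x"
proof (cases "s = t")
  case True
  then show ?thesis
    using assms by (simp add: generator_square simple_reflection_involutive)
next
  case False
  let ?m = "ord (s \<otimes> t)"
  let ?w = "concat (replicate ?m [s, t])"
  have w: "?w \<in> lists S" using assms by auto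
  have fix_s: "word_action ?w (simple_root s) = simple_root s"
    using relator_fixes_root[of s t] assms False by (simp add: alt_replicate)
  have ord: "ord (t \<otimes> s) = ?m" using assms by (simp add: ord_generators_commute)
  \<comment> \<open>The relator for (t, s) is this one reversed, so it acts as the inverse; fixing
    the root of t under one gives it under the other.\<close>
  have rev: "rev (concat (replicate k [t, s])) = concat (replicate k [s, t])" for k
    by (simp add: rev_concat)
  have "word_action (concat (replicate ?m [t, s])) (simple_root t) = simple_root t"
    using relator_fixes_root[of t s] assms False ord by (simp add: alt_replicate)
  with word_action_rev[of "concat (replicate ?m [t, s])" "simple_root t"]
  have fix_t: "word_action ?w (simple_root t) = simple_root t"
    using assms by (simp add: rev)
  define g where "g = gram s t"
  have g: "gram s t = g" "gram t s = g" "gram s s = 1" "gram t t = 1"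
    using assms gram_commute gram_self by (auto simp: g_def)
  have "2 \<le> ?m" using ord_neq_1[of s t] assms False by auto
  then have "0 < (sin (pi / real ?m))\<^sup>2" using sin_pi_div_pos[of ?m] by simp
  then have "g\<^sup>2 < 1" using assms sin_squared_eq[of "pi / real ?m"] by (simp add: g_def gram_def)
  then have D: "1 - g\<^sup>2 \<noteq> 0" by simp
  define p where "p = coxeter_form x (simple_root s)"
  define q where "q = coxeter_form x (simple_root t)"
  \<comment> \<open>Cramer's rule for the orthogonal projection of x to the plane: a and b solve the
    Gram system with right-hand side (p, q).\<close>
  define a where "a = (p - g * q) / (1 - g\<^sup>2)"
  define b where "b = (q - g * p) / (1 - g\<^sup>2)"
  have ab: "a + b * g = p" "a * g + b = q"
  proof -
    have aD: "a * (1 - g\<^sup>2) = p - g * q" and bD: "b * (1 - g\<^sup>2) = q - g * p"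
      using D by (simp_all add: a_def b_def)
    have "(a + b * g) * (1 - g\<^sup>2) = a * (1 - g\<^sup>2) + g * (b * (1 - g\<^sup>2))"
      "(a * g + b) * (1 - g\<^sup>2) = g * (a * (1 - g\<^sup>2)) + b * (1 - g\<^sup>2)"
      by (simp_all add: algebra_simps)
    then have "(a + b * g) * (1 - g\<^sup>2) = p * (1 - g\<^sup>2)" "(a * g + b) * (1 - g\<^sup>2) = q * (1 - g\<^sup>2)"
      unfolding aD bD by (simp_all add: algebra_simps power2_eq_square)
    then show "a + b * g = p" "a * g + b = q" using D by simp_all
  qed
  let ?y = "\<lambda>x. a * simple_root s x + b * simple_root t x"
  let ?z = "\<lambda>r. 1 * x r + (-1) * ?y r"
  have y: "?y \<in> vecs" using assms by auto
  have z: "?z \<in> vecs" using assms y by (intro vecs_lin) auto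
  have "coxeter_form ?z (simple_root s) = 0"
    using assms y ab by (subst form_lin_left) (auto simp: form_lin_left form_simple_roots g p_def)
  moreover have "coxeter_form ?z (simple_root t) = 0"
    using assms y ab by (subst form_lin_left) (auto simp: form_lin_left form_simple_roots g q_def)
  moreover have "set ?w \<subseteq> {s, t}" by auto
  ultimately have fz: "word_action ?w ?z = ?z" by (intro word_action_fixed) auto
  have fy: "word_action ?w ?y = ?y"
    using assms by (subst word_action_lin[OF w]) (auto simp: fix_s fix_t)
  have "x = (\<lambda>r. 1 * ?z r + 1 * ?y r)" by auto
  then have "word_action ?w x = word_action ?w (\<lambda>r. 1 * ?z r + 1 * ?y r)" by simp
  also have "\<dots> = (\<lambda>r. 1 * ?z r + 1 * ?y r)"
    by (subst word_action_lin[OF w z y]) (simp only: fz fy)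
  finally show ?thesis by simp
qed

text \<open>The presentation enters here: words with equal product are joined by insertions and
  deletions of relators, none of which changes the action.\<close>

lemma word_action_cong:
  assumes "xs \<in> lists S" "ys \<in> lists S" "word_prod W xs = word_prod W ys" "x \<in> vecs"
  shows "word_action xs x = word_action ys x"
proof -
  have step: "word_action as x = word_action bs x" if "relator_step S as bs" for as bs
    using that
  proof cases
    case (1 xs ys s t)
    then show ?thesis
      using relator_acts_trivially[of s t "word_action ys x"] assms by (simp add: word_action_append)
  qed
  have "equivclp (relator_step S) xs ys" using presentation assms by blast
  then show ?thesis
    by (induction rule: equivclp_induct) (use step in auto)
qed

section \<open>Action of the group on roots\<close>

text \<open>On \<open>vecs\<close> the action does not depend on the chosen word.\<close>

definition act :: "'a \<Rightarrow> ('a \<Rightarrow> real) \<Rightarrow> 'a \<Rightarrow> real" where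
  "act w = word_action (SOME ws. ws \<in> lists S \<and> word_prod W ws = w)"

lemma act_word_prod:
  assumes "ws \<in> lists S" "x \<in> vecs"
  shows "act (word_prod W ws) x = word_action ws x"
proof -
  let ?ws = "SOME xs. xs \<in> lists S \<and> word_prod W xs = word_prod W ws"
  have "?ws \<in> lists S \<and> word_prod W ?ws = word_prod W ws"
    by (rule someI[of _ ws]) (use assms in simp)
  then show ?thesis unfolding act_def using assms by (intro word_action_cong) auto
qed

lemma act_vecs [simp, intro]: "w \<in> carrier W \<Longrightarrow> x \<in> vecs \<Longrightarrow> act w x \<in> vecs"
  using ex_word[of w] by (auto simp: act_word_prod)

lemma act_lin:
  assumes "w \<in> carrier W" "x \<in> vecs" "y \<in> vecs"
  shows "act w (\<lambda>t. a * x t + b * y t) = (\<lambda>t. a * act w x t + b * act w y t)"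
  using ex_word[OF assms(1)] assms by (auto simp: act_word_prod word_action_lin vecs_lin)

lemma form_act:
  assumes "w \<in> carrier W" "x \<in> vecs" "y \<in> vecs"
  shows "coxeter_form (act w x) (act w y) = coxeter_form x y"
  using ex_word[OF assms(1)] assms by (auto simp: act_word_prod form_word_action)

lemma act_one [simp]: "x \<in> vecs \<Longrightarrow> act \<one> x = x"
  using act_word_prod[of "[]" x] by simp

lemma act_mult:
  assumes "v \<in> carrier W" "w \<in> carrier W" "x \<in> vecs"
  shows "act (v \<otimes> w) x = act v (act w x)"
proof -
  obtain vs ws where "vs \<in> lists S" "word_prod W vs = v" "ws \<in> lists S" "word_prod W ws = w"
    using ex_word assms by metis
  then show ?thesis
    using act_word_prod[of "vs @ ws" x] assms
    by (auto simp: word_prod_append word_action_append act_word_prod)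
qed

lemma act_inv_act [simp]: "w \<in> carrier W \<Longrightarrow> x \<in> vecs \<Longrightarrow> act (inv w) (act w x) = x"
  and act_act_inv [simp]: "w \<in> carrier W \<Longrightarrow> x \<in> vecs \<Longrightarrow> act w (act (inv w) x) = x"
  by (simp_all flip: act_mult)

lemma act_generator: "s \<in> S \<Longrightarrow> x \<in> vecs \<Longrightarrow> act s x = simple_reflection s x"
  using act_word_prod[of "[s]" x] by (simp add: r_one)

section \<open>Length under multiplication by generators\<close>

lemma len_mult_word:
  assumes "v \<in> carrier W" "ws \<in> lists S"
  shows "len (v \<otimes> word_prod W ws) \<le> len v + length ws"
proof -
  obtain vs where "vs \<in> lists S" "length vs = len v" "word_prod W vs = v"
    using ex_reduced_word assms by blast
  then show ?thesis using len_word_le[of "vs @ ws"] assms by (auto simp: word_prod_append)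
qed

lemma len_mult_generator_le: "v \<in> carrier W \<Longrightarrow> s \<in> S \<Longrightarrow> len (v \<otimes> s) \<le> Suc (len v)"
  using len_mult_word[of v "[s]"] by simp

lemma mult_generator_cancel [simp]: "v \<in> carrier W \<Longrightarrow> s \<in> S \<Longrightarrow> v \<otimes> s \<otimes> s = v"
  by (simp add: m_assoc generator_square)

lemma generator_mult_cancel [simp]: "v \<in> carrier W \<Longrightarrow> s \<in> S \<Longrightarrow> s \<otimes> (s \<otimes> v) = v"
  by (simp add: generator_square flip: m_assoc)

lemma inv_mult_cancel [simp]:
  "v \<in> carrier W \<Longrightarrow> w \<in> carrier W \<Longrightarrow> inv v \<otimes> (v \<otimes> w) = w"
  "v \<in> carrier W \<Longrightarrow> w \<in> carrier W \<Longrightarrow> v \<otimes> (inv v \<otimes> w) = w"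
  by (simp_all flip: m_assoc)

lemma len_inv [simp]:
  assumes "w \<in> carrier W"
  shows "len (inv w) = len w"
proof -
  have "len (inv v) \<le> len v" if "v \<in> carrier W" for v
  proof -
    obtain vs where "vs \<in> lists S" "length vs = len v" "word_prod W vs = v"
      using ex_reduced_word \<open>v \<in> carrier W\<close> by blast
    then show ?thesis using len_word_le[of "rev vs"] by (auto simp: word_prod_rev)
  qed
  from this[of w] this[of "inv w"] show ?thesis using assms by auto
qed

lemma len_parity_mult_generator:
  assumes "v \<in> carrier W" "s \<in> S"
  shows "even (len (v \<otimes> s)) = odd (len v)"
proof -
  obtain vs where vs: "vs \<in> lists S" "length vs = len v" "word_prod W vs = v"
    using ex_reduced_word assms by blast
  obtain ws where ws: "ws \<in> lists S" "length ws = len (v \<otimes> s)" "word_prod W ws = v \<otimes> s"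
    using ex_reduced_word[of "v \<otimes> s"] assms by auto
  have "even (length ws) = even (length (vs @ [s]))"
    using vs ws assms by (intro word_parity) (auto simp: word_prod_append)
  then show ?thesis using vs ws by simp
qed

lemma len_mult_generator:
  assumes "v \<in> carrier W" "s \<in> S"
  shows "len (v \<otimes> s) = Suc (len v) \<or> len v = Suc (len (v \<otimes> s))"
proof -
  have "len (v \<otimes> s) \<noteq> len v" using len_parity_mult_generator[OF assms] by metis
  then show ?thesis
    using len_mult_generator_le[OF assms] len_mult_generator_le[of "v \<otimes> s" s] assms by auto
qed

lemma len_generator_mult:
  assumes "v \<in> carrier W" "s \<in> S"
  shows "len (s \<otimes> v) = Suc (len v) \<or> len v = Suc (len (s \<otimes> v))"
proof -
  have "len (s \<otimes> v) = len (inv v \<otimes> s)"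
    using assms len_inv[of "s \<otimes> v"] by (simp add: inv_mult_group generator_inv)
  then show ?thesis using len_mult_generator[of "inv v" s] assms by auto
qed

lemma len_one [simp]: "len \<one> = 0"
  using len_word_le[of "[]"] by simp

lemma len_eq_0: "w \<in> carrier W \<Longrightarrow> len w = 0 \<longleftrightarrow> w = \<one>"
  using ex_reduced_word[of w] by auto

text \<open>The braid relation: one half of the relator is moved to the other side. If m = 2j, then
  (st)^j is its own inverse; if m = 2j + 1, then (st)^(j+1) is the inverse of (st)^j.\<close>

lemma word_prod_alt_braid:
  assumes "s \<in> S" "t \<in> S"
  shows "word_prod W (alt s t (ord (s \<otimes> t))) = word_prod W (alt t s (ord (s \<otimes> t)))"
proof -
  let ?p = "s \<otimes> t" and ?m = "ord (s \<otimes> t)"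
  have c: "s \<in> carrier W" "t \<in> carrier W" using assms by auto
  have ip: "inv ?p = t \<otimes> s" using assms by (simp add: inv_mult_group generator_inv)
  have even_alt: "word_prod W (alt a b (2 * j)) = (a \<otimes> b) [^] j" if "a \<in> S" "b \<in> S" for a b j
  proof (induction j)
    case (Suc j)
    with that show ?case by (subst nat_pow_Suc2) (simp_all add: m_assoc)
  qed simp
  have pow: "(t \<otimes> s) [^] j = inv (?p [^] j)" for j :: nat
    using c by (simp flip: ip add: nat_pow_inv)
  have pm: "?p [^] ?m = \<one>" using c by (simp add: pow_ord_eq_1)
  show ?thesis
  proof (cases "even ?m")
    case True
    then obtain j where j: "?m = 2 * j" by blast
    then have "?p [^] j \<otimes> ?p [^] j = \<one>" using pm c by (simp add: nat_pow_mult mult_2)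
    then have "inv (?p [^] j) = ?p [^] j" using c by (intro inv_equality) auto
    then show ?thesis unfolding j using assms by (simp add: even_alt pow)
  next
    case False
    then obtain j where j: "?m = Suc (2 * j)" by (metis oddE Suc_eq_plus1)
    have "?p [^] Suc j \<otimes> ?p [^] j = ?p [^] (Suc j + j)"
      using c by (intro nat_pow_mult) auto
    also have "Suc j + j = ?m" using j by simp
    finally have "?p [^] Suc j \<otimes> ?p [^] j = \<one>" using pm by simp
    moreover have "?p [^] Suc j = ?p \<otimes> ?p [^] j" using c by (intro nat_pow_Suc2) auto
    ultimately have "(?p \<otimes> ?p [^] j) \<otimes> ?p [^] j = \<one>" by simp
    then have "inv (?p [^] j) = ?p \<otimes> ?p [^] j" using c by (intro inv_equality) auto
    then have "s \<otimes> inv (?p [^] j) = t \<otimes> ?p [^] j"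
      using c assms by (simp add: m_assoc)
    then show ?thesis unfolding j using assms by (simp add: even_alt pow)
  qed
qed

text \<open>
  Strip from \<open>w\<close> the longest alternating word in
  \<open>s\<close> and a right descent \<open>t\<close>: the remaining \<open>v\<close> has neither as a right descent, and
  the alternating word sends \<open>\<alpha>\<^sub>s\<close> to a nonnegative combination of \<open>\<alpha>\<^sub>s\<close> and \<open>\<alpha>\<^sub>t\<close>.
\<close>

lemma act_simple_root_nonneg:
  assumes "w \<in> carrier W" "s \<in> S" "len w < len (w \<otimes> s)"
  shows "0 \<le> act w (simple_root s) x"
  using assms
proof (induction "len w" arbitrary: w s x rule: less_induct)
  case less
  show ?case
  proof (cases "len w = 0")
    case True
    then show ?thesis using less.prems by (simp add: len_eq_0) (simp add: simple_root_def)
  next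
    case False
    then obtain t where t: "t \<in> S" "len (w \<otimes> t) < len w" using ex_right_descent less.prems by auto
    have st: "s \<noteq> t" using less.prems t by auto
    \<comment> \<open>The factorizations are required to be length-additive, which bounds k by the
      length of w. The descent t provides k = 1, so the maximal k is positive and v is strictly
      shorter than w.\<close>
    let ?P = "\<lambda>k. \<exists>v \<in> carrier W. w = v \<otimes> word_prod W (alt s t k) \<and> len w = len v + k"
    have bound: "\<forall>k. ?P k \<longrightarrow> k \<le> len w" by auto
    have P1: "?P 1"
      using t less.prems len_mult_generator[OF less.prems(1) t(1)]
      by (intro bexI[of _ "w \<otimes> t"]) auto
    define k where "k = Greatest ?P"
    have Pk: "?P k" unfolding k_def by (rule GreatestI_nat[of ?P, OF P1 bound[rule_format]])
    have k_max: "j \<le> k" if "?P j" for j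
      unfolding k_def by (rule Greatest_le_nat[of ?P, OF that bound[rule_format]])
    have k1: "1 \<le> k" using k_max P1 by blast
    obtain v where v: "v \<in> carrier W" "w = v \<otimes> word_prod W (alt s t k)" "len w = len v + k"
      using Pk by blast
    \<comment> \<open>A descent r of v is either the next letter of the alternating word, which
      would then be longer than maximal, or its first letter, which would cancel and make w too
      short.\<close>
    have asc: "len v < len (v \<otimes> r)" if r: "r \<in> {s, t}" for r
    proof (rule ccontr)
      assume "\<not> len v < len (v \<otimes> r)"
      moreover have rS: "r \<in> S" using r t less.prems by auto
      ultimately have lv: "len v = Suc (len (v \<otimes> r))" using len_mult_generator[of v r] v by auto
      show False
      proof (cases "r = (if even k then t else s)")
        case True
        have "w = (v \<otimes> r) \<otimes> (r \<otimes> word_prod W (alt s t k))"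
          using v rS t less.prems by (simp add: m_assoc)
        also have "r \<otimes> word_prod W (alt s t k) = word_prod W (alt s t (Suc k))" using True by simp
        finally have "?P (Suc k)" using v lv rS by (intro bexI[of _ "v \<otimes> r"]) auto
        then show False using k_max by fastforce
      next
        case False
        obtain j where j: "k = Suc j" using k1 by (cases k) auto
        then have "alt s t k = r # alt s t j" using False r by auto
        then have "w = (v \<otimes> r) \<otimes> word_prod W (alt s t j)"
          using v rS t less.prems by (simp add: m_assoc)
        then have "len w \<le> len (v \<otimes> r) + j"
          using len_mult_word[of "v \<otimes> r" "alt s t j"] v rS t less.prems by auto
        then show False using v lv j by simp
      qed
    qed
    have pos: "0 \<le> act v (simple_root r) x" if "r \<in> {s, t}" for r x
      using less.hyps[of v r x] asc[OF that] v k1 that t less.prems by auto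
    let ?m = "ord (s \<otimes> t)"
    \<comment> \<open>An alternating word of length m could be rewritten by the braid relation to
      end in s, making s a right descent of w. The strict bound puts both Chebyshev indices k and k
      + 1 in the range where the sine is nonnegative.\<close>
    have k_less: "?m = 0 \<or> k < ?m"
    proof (rule ccontr)
      assume "\<not> ?thesis"
      then obtain j n where j: "k = j + ?m" and n: "?m = Suc n"
        by (metis le_Suc_ex not_less add.commute not0_implies_Suc)
      obtain xs where xs: "set xs \<subseteq> {s, t}" "length xs = j" "alt s t k = xs @ alt s t ?m"
        using alt_add[of s t j ?m] j by auto
      have L: "xs \<in> lists S" "alt s t ?m \<in> lists S" "alt s t n \<in> lists S"
        using xs t less.prems by auto
      have "word_prod W (alt s t k) = word_prod W xs \<otimes> word_prod W (alt t s ?m)"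
        using xs L word_prod_alt_braid[of s t] t less.prems by (simp add: word_prod_append)
      also have "word_prod W (alt t s ?m) = word_prod W (alt s t n) \<otimes> s"
        using L less.prems unfolding n alt_snoc by (simp add: word_prod_append)
      finally have "w = v \<otimes> word_prod W (xs @ alt s t n) \<otimes> s"
        using v L less.prems by (simp add: word_prod_append m_assoc)
      then have "w \<otimes> s = v \<otimes> word_prod W (xs @ alt s t n)"
        using v L less.prems by simp
      then have "len (w \<otimes> s) \<le> len v + (j + n)"
        using len_mult_word[of v "xs @ alt s t n"] v L xs by auto
      then show False using less.prems v j n by simp
    qed
    let ?c = "- gram s t"
    have nn: "0 \<le> cheb ?c k" "0 \<le> cheb ?c (Suc k)"
      using k_less cheb_gram_nonneg[of s t] t st less.prems by auto
    have "act w (simple_root s) = act v (word_action (alt s t k) (simple_root s))"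
      using v t less.prems by (simp add: act_mult act_word_prod)
    then show ?thesis
      using nn pos v t less.prems unfolding word_action_alt[OF less.prems(2) t(1)]
      by (cases "even k") (simp_all add: act_lin del: cheb.simps)
  qed
qed

text \<open>Since s negates its own root, the claim is the nonnegative case for
  \<open>w \<otimes> s\<close>.\<close>

lemma act_simple_root_nonpos:
  assumes "w \<in> carrier W" "s \<in> S" "len (w \<otimes> s) < len w"
  shows "act w (simple_root s) x \<le> 0"
proof -
  have "act (w \<otimes> s) (simple_root s) = act w (\<lambda>t. (-1) * simple_root s t + 0 * simple_root s t)"
    using assms
    by (simp add: act_mult act_generator simple_reflection_def form_simple_roots gram_self)
  also have "\<dots> = (\<lambda>t. (-1) * act w (simple_root s) t + 0 * act w (simple_root s) t)"
    using assms by (intro act_lin) auto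
  finally have "act (w \<otimes> s) (simple_root s) = (\<lambda>t. - act w (simple_root s) t)" by simp
  moreover have "0 \<le> act (w \<otimes> s) (simple_root s) x"
    using assms by (intro act_simple_root_nonneg) auto
  ultimately show ?thesis by simp
qed

text \<open>An element that acts trivially has no right descent, since a descent would send a simple
  root to a nonpositive vector; so its length is 0.\<close>

lemma act_faithful:
  assumes "v \<in> carrier W" "w \<in> carrier W" "\<And>x. x \<in> vecs \<Longrightarrow> act v x = act w x"
  shows "v = w"
proof -
  let ?g = "inv v \<otimes> w"
  have g: "?g \<in> carrier W" using assms by auto
  have "\<not> len (?g \<otimes> s) < len ?g" if s: "s \<in> S" for s
  proof
    assume "len (?g \<otimes> s) < len ?g"
    then have "act ?g (simple_root s) s \<le> 0" using act_simple_root_nonpos g s by blast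
    moreover have "act ?g (simple_root s) = simple_root s"
      using assms s by (simp add: act_mult flip: assms(3))
    ultimately show False by (simp add: simple_root_def)
  qed
  then have "len ?g = 0" using ex_right_descent[OF g] by auto
  then have "?g = \<one>" using len_eq_0[OF g] by simp
  then have "v \<otimes> ?g = v" using assms by simp
  then show ?thesis using assms by (simp flip: m_assoc)
qed

section \<open>Roots and reflections\<close>

lemma roots_act: "roots = {act w (simple_root s) | w s. w \<in> carrier W \<and> s \<in> S}"
proof -
  have "\<exists>v s'. word_action ws (simple_root s) = act v (simple_root s') \<and> v \<in> carrier W \<and> s' \<in> S"
    if "ws \<in> lists S" "s \<in> S" for ws s
    using that act_word_prod[of ws "simple_root s"]
    by (intro exI[of _ "word_prod W ws"] exI[of _ s]) auto
  moreover have "\<exists>ws s'. act w (simple_root s) = word_action ws (simple_root s') \<and> ws \<in> lists S \<and> s' \<in> S"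
    if "w \<in> carrier W" "s \<in> S" for w s
    using ex_word[OF that(1)] that act_word_prod by (metis simple_root_vecs)
  ultimately show ?thesis unfolding roots_def by blast
qed

lemma rootE:
  assumes "\<gamma> \<in> roots"
  obtains w s where "w \<in> carrier W" "s \<in> S" "\<gamma> = act w (simple_root s)"
  using assms by (auto simp: roots_act)

lemma simple_root_roots [simp, intro]: "s \<in> S \<Longrightarrow> simple_root s \<in> roots"
  unfolding roots_act by (rule CollectI, rule exI[of _ "\<one>"], rule exI[of _ s]) simp

lemma roots_vecs [simp, intro]: "\<gamma> \<in> roots \<Longrightarrow> \<gamma> \<in> vecs"
  by (auto elim!: rootE)

lemma act_roots [simp, intro]:
  assumes "w \<in> carrier W" "\<gamma> \<in> roots"
  shows "act w \<gamma> \<in> roots"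
proof -
  obtain v s where "v \<in> carrier W" "s \<in> S" "\<gamma> = act v (simple_root s)" using assms by (auto elim: rootE)
  then have "act w \<gamma> = act (w \<otimes> v) (simple_root s)" "w \<otimes> v \<in> carrier W" "s \<in> S"
    using assms by (auto simp: act_mult)
  then show ?thesis unfolding roots_act by blast
qed

lemma form_root_self [simp]: "\<gamma> \<in> roots \<Longrightarrow> coxeter_form \<gamma> \<gamma> = 1"
  by (auto elim!: rootE simp: form_act form_simple_roots gram_self)

lemma root_neq_0: "\<gamma> \<in> roots \<Longrightarrow> \<exists>x. \<gamma> x \<noteq> 0"
proof (rule ccontr)
  assume "\<gamma> \<in> roots" "\<nexists>x. \<gamma> x \<noteq> 0"
  moreover from this have "coxeter_form \<gamma> \<gamma> = 0" by (simp add: coxeter_form_def)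
  ultimately show False by simp
qed

lemma root_sign:
  assumes "\<gamma> \<in> roots"
  shows "(\<forall>x. 0 \<le> \<gamma> x) \<or> (\<forall>x. \<gamma> x \<le> 0)"
proof -
  obtain w s where "w \<in> carrier W" "s \<in> S" "\<gamma> = act w (simple_root s)" using assms by (auto elim: rootE)
  then show ?thesis
    using len_mult_generator[of w s] act_simple_root_nonneg[of w s] act_simple_root_nonpos[of w s] by auto
qed

lemma act_scale:
  assumes "w \<in> carrier W" "x \<in> vecs"
  shows "act w (\<lambda>t. a * x t) = (\<lambda>t. a * act w x t)"
  using act_lin[of w x x a 0] assms by simp

lemma act_minus:
  assumes "w \<in> carrier W" "x \<in> vecs"
  shows "act w (\<lambda>t. - x t) = (\<lambda>t. - act w x t)"
  using act_scale[of w x "-1"] assms by simp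

lemma act_generator_self: "s \<in> S \<Longrightarrow> act s (simple_root s) = (\<lambda>t. - simple_root s t)"
  by (simp add: act_generator simple_reflection_def form_simple_roots gram_self)

lemma roots_minus [simp, intro]:
  assumes "\<gamma> \<in> roots"
  shows "(\<lambda>x. - \<gamma> x) \<in> roots"
proof -
  obtain w s where *: "w \<in> carrier W" "s \<in> S" "\<gamma> = act w (simple_root s)" using assms by (auto elim: rootE)
  then have "(\<lambda>x. - \<gamma> x) = act (w \<otimes> s) (simple_root s)"
    by (simp add: act_mult act_generator_self act_minus)
  with * show ?thesis by auto
qed

lemma positive_rootsD: "\<gamma> \<in> positive_roots \<Longrightarrow> \<gamma> \<in> roots"
  by (simp add: positive_roots_def)

lemma minus_positive_roots:
  assumes "\<gamma> \<in> roots"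
  shows "(\<lambda>x. - \<gamma> x) \<in> positive_roots \<longleftrightarrow> \<gamma> \<notin> positive_roots"
proof -
  obtain x where "\<gamma> x \<noteq> 0" using root_neq_0 assms by blast
  then have "\<not> ((\<forall>x. 0 \<le> \<gamma> x) \<and> (\<forall>x. \<gamma> x \<le> 0))" by (auto intro: antisym)
  then show ?thesis using root_sign[OF assms] assms by (auto simp: positive_roots_def)
qed

lemma act_simple_root_positive_iff:
  assumes "w \<in> carrier W" "s \<in> S"
  shows "act w (simple_root s) \<in> positive_roots \<longleftrightarrow> len w < len (w \<otimes> s)"
proof (cases "len w < len (w \<otimes> s)")
  case True
  then show ?thesis using assms act_simple_root_nonneg by (auto simp: positive_roots_def)
next
  case False
  then have "len (w \<otimes> s) < len w" using len_mult_generator[of w s] assms by auto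
  then have "(\<lambda>x. - act w (simple_root s) x) \<in> positive_roots"
    using act_simple_root_nonpos assms by (auto simp: positive_roots_def)
  then show ?thesis using False minus_positive_roots assms by auto
qed

lemma act_conjugate:
  assumes "w \<in> carrier W" "s \<in> S" "x \<in> vecs"
  shows "act (w \<otimes> s \<otimes> inv w) x =
    (\<lambda>r. x r - 2 * coxeter_form x (act w (simple_root s)) * act w (simple_root s) r)"
proof -
  have form: "coxeter_form (act (inv w) x) (simple_root s) = coxeter_form x (act w (simple_root s))"
    using form_act[of w "act (inv w) x" "simple_root s"] assms by simp
  have "act (w \<otimes> s \<otimes> inv w) x = act w (simple_reflection s (act (inv w) x))"
    using assms by (simp add: act_mult act_generator m_assoc)
  also have "\<dots> = (\<lambda>r. 1 * act w (act (inv w) x) r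
      + (- 2 * coxeter_form (act (inv w) x) (simple_root s)) * act w (simple_root s) r)"
    unfolding simple_reflection_lin_form using assms by (intro act_lin) auto
  finally show ?thesis using assms by (simp add: form)
qed

text \<open>By \<open>act_conjugate\<close> the root determines how the conjugate acts, and
  faithfulness lifts the equality to the group. This makes the description in
  \<open>root_reflection\<close> well defined.\<close>

lemma conjugates_eq:
  assumes "v \<in> carrier W" "w \<in> carrier W" "s \<in> S" "t \<in> S"
    and "act v (simple_root s) = act w (simple_root t)"
  shows "v \<otimes> s \<otimes> inv v = w \<otimes> t \<otimes> inv w"
proof (rule act_faithful)
  show "act (v \<otimes> s \<otimes> inv v) x = act (w \<otimes> t \<otimes> inv w) x" if "x \<in> vecs" for x
    using that assms by (simp only: act_conjugate)
qed (use assms in auto)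

lemma root_reflection_act_simple:
  assumes "w \<in> carrier W" "s \<in> S"
  shows "root_reflection (act w (simple_root s)) = w \<otimes> s \<otimes> inv w"
  unfolding root_reflection_def
proof (rule the_equality)
  obtain ws where ws: "ws \<in> lists S" "word_prod W ws = w" using ex_word assms by blast
  then show "\<exists>ws\<in>lists S. \<exists>s'\<in>S. act w (simple_root s) = word_action ws (simple_root s') \<and>
      w \<otimes> s \<otimes> inv w = word_prod W ws \<otimes> s' \<otimes> inv (word_prod W ws)"
    using act_word_prod[of ws "simple_root s"] assms by (intro bexI[of _ ws] bexI[of _ s]) auto
next
  fix t
  assume "\<exists>ws\<in>lists S. \<exists>s'\<in>S. act w (simple_root s) = word_action ws (simple_root s') \<and>
      t = word_prod W ws \<otimes> s' \<otimes> inv (word_prod W ws)"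
  then obtain ws s' where *: "ws \<in> lists S" "s' \<in> S" "act w (simple_root s) = word_action ws (simple_root s')"
      "t = word_prod W ws \<otimes> s' \<otimes> inv (word_prod W ws)" by blast
  then have "act w (simple_root s) = act (word_prod W ws) (simple_root s')"
    by (simp add: act_word_prod)
  then show "t = w \<otimes> s \<otimes> inv w"
    using * assms conjugates_eq[of w "word_prod W ws" s s'] by auto
qed

lemma act_root_reflection:
  assumes "\<gamma> \<in> roots" "x \<in> vecs"
  shows "act (root_reflection \<gamma>) x = (\<lambda>r. x r - 2 * coxeter_form x \<gamma> * \<gamma> r)"
  using assms by (auto elim!: rootE simp: root_reflection_act_simple act_conjugate)

lemma root_reflection_reflections:
  assumes "\<gamma> \<in> roots"
  shows "root_reflection \<gamma> \<in> reflections"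
proof -
  obtain w s where "w \<in> carrier W" "s \<in> S" "\<gamma> = act w (simple_root s)" using assms by (auto elim: rootE)
  then show ?thesis unfolding reflections_def using root_reflection_act_simple by blast
qed

lemma reflections_closed [simp, intro]: "t \<in> reflections \<Longrightarrow> t \<in> carrier W"
  by (auto simp: reflections_def)

lemma reflection_square:
  assumes "t \<in> reflections"
  shows "t \<otimes> t = \<one>"
proof -
  obtain w s where *: "w \<in> carrier W" "s \<in> S" "t = w \<otimes> s \<otimes> inv w"
    using assms unfolding reflections_def by blast
  then have "t \<otimes> t = w \<otimes> (s \<otimes> (inv w \<otimes> w) \<otimes> s) \<otimes> inv w"
    by (simp add: m_assoc del: l_inv)
  then show ?thesis using * by (simp add: generator_square)
qed

lemma reflection_inv: "t \<in> reflections \<Longrightarrow> inv t = t"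
  by (intro inv_equality) (auto simp: reflection_square)

lemma mult_reflection_cancel [simp]:
  "v \<in> carrier W \<Longrightarrow> t \<in> reflections \<Longrightarrow> v \<otimes> t \<otimes> t = v"
  by (simp add: m_assoc reflection_square)

lemma root_reflection_minus:
  assumes "\<gamma> \<in> roots"
  shows "root_reflection (\<lambda>x. - \<gamma> x) = root_reflection \<gamma>"
proof -
  obtain w s where *: "w \<in> carrier W" "s \<in> S" "\<gamma> = act w (simple_root s)" using assms by (auto elim: rootE)
  then have "(\<lambda>x. - \<gamma> x) = act (w \<otimes> s) (simple_root s)"
    by (simp add: act_mult act_generator_self act_minus)
  then show ?thesis
    using * by (simp add: root_reflection_act_simple inv_mult_group m_assoc generator_inv)
qed

lemma reflectionE:
  assumes "t \<in> reflections"
  obtains \<beta> where "\<beta> \<in> positive_roots" "t = root_reflection \<beta>"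
proof -
  obtain w s where *: "w \<in> carrier W" "s \<in> S" "t = w \<otimes> s \<otimes> inv w"
    using assms unfolding reflections_def by blast
  define \<gamma> where "\<gamma> = act w (simple_root s)"
  have "\<gamma> \<in> roots" "t = root_reflection \<gamma>"
    using * by (simp_all add: \<gamma>_def root_reflection_act_simple)
  show ?thesis
  proof (cases "\<gamma> \<in> positive_roots")
    case True
    then show ?thesis using that \<open>t = root_reflection \<gamma>\<close> by blast
  next
    case False
    then have "(\<lambda>x. - \<gamma> x) \<in> positive_roots" using minus_positive_roots \<open>\<gamma> \<in> roots\<close> by blast
    then show ?thesis using that root_reflection_minus[OF \<open>\<gamma> \<in> roots\<close>] \<open>t = root_reflection \<gamma>\<close> by metis
  qed
qed

section \<open>Sign changes of roots and strong exchange\<close>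

lemma proportional_roots:
  assumes "\<alpha> \<in> positive_roots" "\<beta> \<in> positive_roots" "\<And>x. \<alpha> x = k * \<beta> x"
  shows "\<alpha> = \<beta>"
proof -
  have r: "\<alpha> \<in> roots" "\<beta> \<in> roots" using assms positive_rootsD by auto
  have eq: "\<alpha> = (\<lambda>x. k * \<beta> x)" using assms by auto
  \<comment> \<open>Roots are unit vectors, so the factor can only be 1 or -1, and positivity
    excludes -1.\<close>
  have "1 = coxeter_form \<alpha> \<alpha>" using r by simp
  also have "\<dots> = k * coxeter_form \<beta> \<alpha>"
    using form_lin_left[of \<beta> \<beta> \<alpha> k 0] r by (simp flip: eq)
  also have "coxeter_form \<beta> \<alpha> = k * coxeter_form \<beta> \<beta>"
    using form_lin_right[of \<beta> \<beta> \<beta> k 0] r by (simp flip: eq)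
  finally have "k * k = 1" using r by simp
  then have "k = 1 \<or> k = -1" by (simp add: square_eq_1_iff)
  moreover have False if "k = -1"
  proof -
    have "\<alpha> = (\<lambda>x. - \<beta> x)" using assms(3) that by auto
    then show False using assms minus_positive_roots[of \<beta>] r by simp
  qed
  ultimately show ?thesis using eq by auto
qed

text \<open>The reflection changes the s-coordinate only. If the image is negative, all other
  coordinates vanish, so the root is a multiple of the simple root of s.\<close>

lemma simple_reflection_positive_root:
  assumes "s \<in> S" "\<gamma> \<in> positive_roots" "\<gamma> \<noteq> simple_root s"
  shows "act s \<gamma> \<in> positive_roots"
proof (rule ccontr)
  assume "act s \<gamma> \<notin> positive_roots"
  have r: "\<gamma> \<in> roots" using assms positive_rootsD by auto
  then have "(\<lambda>x. - act s \<gamma> x) \<in> positive_roots"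
    using \<open>act s \<gamma> \<notin> positive_roots\<close> minus_positive_roots[of "act s \<gamma>"] assms by auto
  then have le: "act s \<gamma> x \<le> 0" for x by (simp add: positive_roots_def)
  have ge: "0 \<le> \<gamma> x" for x using assms by (simp add: positive_roots_def)
  have "\<gamma> x = \<gamma> s * simple_root s x" for x
  proof (cases "x = s")
    case False
    then have "act s \<gamma> x = \<gamma> x" using assms r by (simp add: act_generator simple_reflection_def simple_root_def)
    then have "\<gamma> x = 0" using le[of x] ge[of x] by simp
    then show ?thesis using False by (simp add: simple_root_def)
  qed (simp add: simple_root_def)
  moreover have "simple_root s \<in> positive_roots"
    using assms by (auto simp: positive_roots_def) (simp add: simple_root_def)
  ultimately show False using proportional_roots assms by blast
qed

text \<open>Letters act from right to left. At some letter s the image of \<beta> turns from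
  positive to negative; just before that it must be the simple root of s, so \<beta> is the image of
  this root under the inverse of the suffix \<open>ys\<close>.\<close>

lemma word_split_at_root:
  assumes "ws \<in> lists S" "\<beta> \<in> positive_roots" "word_action ws \<beta> \<notin> positive_roots"
  shows "\<exists>xs s ys. ws = xs @ s # ys \<and> root_reflection \<beta> = word_prod W (rev ys @ s # ys)"
  using assms(1,3)
proof (induction ws)
  case Nil
  then show ?case using assms by simp
next
  case (Cons s ws)
  show ?case
  proof (cases "word_action ws \<beta> \<in> positive_roots")
    case False
    then obtain xs s' ys where "ws = xs @ s' # ys" "root_reflection \<beta> = word_prod W (rev ys @ s' # ys)"
      using Cons by auto
    then have "s # ws = (s # xs) @ s' # ys \<and> root_reflection \<beta> = word_prod W (rev ys @ s' # ys)" by simp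
    then show ?thesis by blast
  next
    case True
    have b: "\<beta> \<in> roots" using assms positive_rootsD by auto
    have "act s (word_action ws \<beta>) \<notin> positive_roots"
      using Cons b by (simp add: act_generator)
    then have eq: "word_action ws \<beta> = simple_root s"
      using simple_reflection_positive_root[of s "word_action ws \<beta>"] True Cons by auto
    let ?w = "word_prod W ws"
    have S: "ws \<in> lists S" "s \<in> S" "?w \<in> carrier W" "s \<in> carrier W" using Cons by auto
    have "act ?w \<beta> = simple_root s" using eq S b by (simp add: act_word_prod)
    then have "act (inv ?w) (simple_root s) = \<beta>" using S b by (simp flip: \<open>act ?w \<beta> = simple_root s\<close>)
    then have "root_reflection \<beta> = inv ?w \<otimes> s \<otimes> ?w"
      using root_reflection_act_simple[of "inv ?w" s] S by simp
    also have "\<dots> = word_prod W (rev ws @ s # ws)"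
      using S by (simp add: word_prod_append word_prod_rev m_assoc)
    finally show ?thesis by (intro exI[of _ "[]"] exI[of _ s] exI[of _ ws]) simp
  qed
qed

text \<open>The reflection is s conjugated by the suffix behind it, so multiplying by it cancels
  exactly that letter.\<close>

lemma strong_exchange_word:
  assumes "ws \<in> lists S" "\<beta> \<in> positive_roots" "act (word_prod W ws) \<beta> \<notin> positive_roots"
  shows "\<exists>xs s ys. ws = xs @ s # ys \<and> root_reflection \<beta> = word_prod W (rev ys @ s # ys) \<and>
    word_prod W ws \<otimes> root_reflection \<beta> = word_prod W (xs @ ys)"
proof -
  have "\<beta> \<in> vecs" using assms positive_rootsD by auto
  then obtain xs s ys where *: "ws = xs @ s # ys" "root_reflection \<beta> = word_prod W (rev ys @ s # ys)"
    using word_split_at_root[of ws \<beta>] assms by (auto simp: act_word_prod)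
  let ?x = "word_prod W xs" and ?y = "word_prod W ys"
  have S: "xs \<in> lists S" "s \<in> S" "ys \<in> lists S" "?x \<in> carrier W" "s \<in> carrier W" "?y \<in> carrier W"
    using * assms by auto
  have "word_prod W ws \<otimes> root_reflection \<beta> = ?x \<otimes> (s \<otimes> (?y \<otimes> (inv ?y \<otimes> (s \<otimes> ?y))))"
    unfolding * using S by (simp add: word_prod_append word_prod_rev m_assoc)
  also have "?y \<otimes> (inv ?y \<otimes> (s \<otimes> ?y)) = s \<otimes> ?y"
    using S by (simp flip: m_assoc)
  finally have "word_prod W ws \<otimes> root_reflection \<beta> = word_prod W (xs @ ys)"
    using S by (simp add: word_prod_append)
  with * show ?thesis by blast
qed

lemma len_mult_root_reflection:
  assumes "u \<in> carrier W" "\<beta> \<in> positive_roots" "act u \<beta> \<notin> positive_roots"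
  shows "len (u \<otimes> root_reflection \<beta>) < len u"
proof -
  obtain ws where ws: "ws \<in> lists S" "length ws = len u" "word_prod W ws = u"
    using ex_reduced_word assms by blast
  then obtain xs s ys where *: "ws = xs @ s # ys" "u \<otimes> root_reflection \<beta> = word_prod W (xs @ ys)"
    using strong_exchange_word[of ws \<beta>] assms by auto
  then have "xs @ ys \<in> lists S" using ws by auto
  then show ?thesis using len_word_le[of "xs @ ys"] ws * by simp
qed

lemma act_root_reflection_self:
  assumes "\<beta> \<in> roots"
  shows "act (root_reflection \<beta>) \<beta> = (\<lambda>x. - \<beta> x)"
  using assms by (simp add: act_root_reflection)

text \<open>The reflection negates \<beta>, so one of u and
  \<open>u \<otimes> root_reflection \<beta>\<close> sends \<beta> to a negative root and is the one
  shortened by strong exchange.\<close>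

lemma act_positive_iff:
  assumes "u \<in> carrier W" "\<beta> \<in> positive_roots"
  shows "act u \<beta> \<in> positive_roots \<longleftrightarrow> len u < len (u \<otimes> root_reflection \<beta>)"
proof (cases "act u \<beta> \<in> positive_roots")
  case False
  then show ?thesis using len_mult_root_reflection[OF assms] by simp
next
  case True
  let ?t = "root_reflection \<beta>"
  have b: "\<beta> \<in> roots" "?t \<in> reflections" using assms positive_rootsD root_reflection_reflections by auto
  have "act (u \<otimes> ?t) \<beta> = (\<lambda>x. - act u \<beta> x)"
    using b assms by (simp add: act_mult act_root_reflection_self act_minus)
  then have "act (u \<otimes> ?t) \<beta> \<notin> positive_roots"
    using True minus_positive_roots[of "act u \<beta>"] b assms by auto
  then have "len (u \<otimes> ?t \<otimes> ?t) < len (u \<otimes> ?t)"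
    using b assms by (intro len_mult_root_reflection) auto
  then show ?thesis using True b assms by simp
qed

lemma len_mult_reflection_neq:
  assumes "u \<in> carrier W" "t \<in> reflections"
  shows "len (u \<otimes> t) \<noteq> len u"
proof -
  obtain \<beta> where \<beta>: "\<beta> \<in> positive_roots" "t = root_reflection \<beta>" using assms by (auto elim: reflectionE)
  show ?thesis
    using act_positive_iff[OF assms(1) \<beta>(1)] len_mult_root_reflection[OF assms(1) \<beta>(1)] \<beta>(2) by auto
qed

section \<open>Labels of incoming edges and left multiplication\<close>

definition down :: "'a \<Rightarrow> 'a set" where
  "down v = {t \<in> reflections. len (v \<otimes> t) < len v}"

text \<open>Strong exchange recovers a label t from the position of the deleted letter in one fixed
  word for v.\<close>

lemma finite_down [simp, intro]:
  assumes "v \<in> carrier W"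
  shows "finite (down v)"
proof -
  obtain ws where ws: "ws \<in> lists S" "word_prod W ws = v" using ex_word assms by blast
  have "down v \<subseteq> (\<lambda>k. word_prod W (rev (drop (Suc k) ws) @ drop k ws)) ` {..length ws}"
  proof
    fix t
    assume "t \<in> down v"
    then have "t \<in> reflections" "len (v \<otimes> t) < len v" by (auto simp: down_def)
    moreover from this obtain \<beta> where \<beta>: "\<beta> \<in> positive_roots" "t = root_reflection \<beta>" by (auto elim: reflectionE)
    ultimately have "act v \<beta> \<notin> positive_roots" using act_positive_iff assms by auto
    then obtain xs s ys where "ws = xs @ s # ys" "t = word_prod W (rev ys @ s # ys)"
      using strong_exchange_word[of ws \<beta>] ws \<beta> by auto
    then show "t \<in> (\<lambda>k. word_prod W (rev (drop (Suc k) ws) @ drop k ws)) ` {..length ws}"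
      by (intro image_eqI[of _ _ "length xs"]) auto
  qed
  then show ?thesis using finite_subset by blast
qed

text \<open>The label of the edge between u and \<open>s \<otimes> u\<close>, in whichever direction
  it points.\<close>

definition conj_refl :: "'a \<Rightarrow> 'a \<Rightarrow> 'a" where
  "conj_refl s u = inv u \<otimes> s \<otimes> u"

lemma conj_refl_reflections [simp, intro]:
  "s \<in> S \<Longrightarrow> u \<in> carrier W \<Longrightarrow> conj_refl s u \<in> reflections"
  unfolding conj_refl_def reflections_def
  by (rule CollectI, rule exI[of _ "inv u"], rule exI[of _ s]) simp

lemma conj_refl_root: "s \<in> S \<Longrightarrow> u \<in> carrier W \<Longrightarrow> conj_refl s u = root_reflection (act (inv u) (simple_root s))"
  by (simp add: conj_refl_def root_reflection_act_simple)

lemma mult_conj_refl: "s \<in> S \<Longrightarrow> u \<in> carrier W \<Longrightarrow> u \<otimes> conj_refl s u = s \<otimes> u"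
  by (simp add: conj_refl_def flip: m_assoc)

lemma conj_refl_generator_mult [simp]:
  "s \<in> S \<Longrightarrow> u \<in> carrier W \<Longrightarrow> conj_refl s (s \<otimes> u) = conj_refl s u"
  by (simp add: conj_refl_def inv_mult_group generator_inv m_assoc)

lemma left_ascent_iff:
  assumes "s \<in> S" "u \<in> carrier W"
  shows "len u < len (s \<otimes> u) \<longleftrightarrow> act (inv u) (simple_root s) \<in> positive_roots"
proof -
  have "len (inv u \<otimes> s) = len (s \<otimes> u)"
    using assms len_inv[of "s \<otimes> u"] by (simp add: inv_mult_group generator_inv)
  then show ?thesis using act_simple_root_positive_iff[of "inv u" s] assms by simp
qed

text \<open>The direction of the edge is the sign of \<open>act u \<beta>\<close>. A generator
  changes the sign of its own simple root and its negative only, and these two correspond to the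
  excluded label.\<close>

lemma left_mult_edge:
  assumes "s \<in> S" "u \<in> carrier W" "t \<in> reflections" "t \<noteq> conj_refl s u"
  shows "len u < len (u \<otimes> t) \<longleftrightarrow> len (s \<otimes> u) < len (s \<otimes> u \<otimes> t)"
proof -
  obtain \<beta> where \<beta>: "\<beta> \<in> positive_roots" "t = root_reflection \<beta>" using assms by (auto elim: reflectionE)
  then have b: "\<beta> \<in> roots" using positive_rootsD by auto
  define \<gamma> where "\<gamma> = act u \<beta>"
  have g: "\<gamma> \<in> roots" using assms b by (auto simp: \<gamma>_def)
  have beta: "\<beta> = act (inv u) \<gamma>" using assms b by (simp add: \<gamma>_def)
  have g1: "\<gamma> \<noteq> simple_root s" using assms \<beta> beta by (auto simp: conj_refl_root)
  have g2: "(\<lambda>x. - \<gamma> x) \<noteq> simple_root s"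
  proof
    assume "(\<lambda>x. - \<gamma> x) = simple_root s"
    then have "act (inv u) (simple_root s) = (\<lambda>x. - \<beta> x)"
      using act_minus[of "inv u" \<gamma>] beta g assms by auto
    then show False using assms b \<beta> by (simp add: conj_refl_root root_reflection_minus)
  qed
  have "act s \<gamma> \<in> positive_roots \<longleftrightarrow> \<gamma> \<in> positive_roots"
  proof (cases "\<gamma> \<in> positive_roots")
    case True
    then show ?thesis using simple_reflection_positive_root g1 assms by auto
  next
    case False
    then have "act s (\<lambda>x. - \<gamma> x) \<in> positive_roots"
      using simple_reflection_positive_root[of s "\<lambda>x. - \<gamma> x"] g2 assms minus_positive_roots[OF g] by auto
    then have "(\<lambda>x. - act s \<gamma> x) \<in> positive_roots" using act_minus[of s \<gamma>] g assms by auto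
    then show ?thesis using False minus_positive_roots[of "act s \<gamma>"] g assms by auto
  qed
  then show ?thesis
    using act_positive_iff[of u \<beta>] act_positive_iff[of "s \<otimes> u" \<beta>] \<beta> b assms
    by (simp add: \<gamma>_def act_mult)
qed



section \<open>Reflection orders\<close>

lemma reflection_orderD:
  assumes "reflection_order r"
  shows "trans r" "irrefl r" "total_on reflections r" "r \<subseteq> reflections \<times> reflections"
  using assms by (auto simp: reflection_order_def strict_linear_order_on_def)

lemma reflection_order_between:
  assumes "reflection_order r" "\<alpha> \<in> positive_roots" "\<beta> \<in> positive_roots" "\<alpha> \<noteq> \<beta>" "0 < l" "0 < m"
    and "\<gamma> \<in> positive_roots" "\<And>t. \<gamma> t = l * \<alpha> t + m * \<beta> t"
  shows "(root_reflection \<alpha>, root_reflection \<gamma>) \<in> r \<and> (root_reflection \<gamma>, root_reflection \<beta>) \<in> r \<or>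
    (root_reflection \<beta>, root_reflection \<gamma>) \<in> r \<and> (root_reflection \<gamma>, root_reflection \<alpha>) \<in> r"
proof -
  have "\<gamma> = (\<lambda>t. l * \<alpha> t + m * \<beta> t)" using assms by auto
  then show ?thesis using assms unfolding reflection_order_def Let_def by blast
qed

lemma reflection_order_asym:
  "reflection_order r \<Longrightarrow> (a, b) \<in> r \<Longrightarrow> (b, a) \<notin> r"
  using reflection_orderD(1,2) by (metis irreflD transE)

text \<open>
  The sign rule: the positive roots of \<open>t\<close>, of \<open>u\<^sup>-\<^sup>1su\<close> and of its conjugate by \<open>t\<close> are coplanar, and
  the sign of \<open>t\<close> applied to the second root decides which of the three is between the other two.
\<close>

lemma left_ascent_sign_rule:
  assumes r: "reflection_order r" and "s \<in> S" "u \<in> carrier W" "t \<in> reflections" "t \<noteq> conj_refl s u"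
  shows "(len u < len (s \<otimes> u) \<longleftrightarrow> (t, conj_refl s u) \<in> r) \<longleftrightarrow>
    (len (u \<otimes> t) < len (s \<otimes> (u \<otimes> t)) \<longleftrightarrow> (t, conj_refl s (u \<otimes> t)) \<in> r)"
proof -
  obtain \<beta> where \<beta>: "\<beta> \<in> positive_roots" "t = root_reflection \<beta>" using assms by (auto elim: reflectionE)
  then have b: "\<beta> \<in> roots" using positive_rootsD by auto
  let ?\<gamma> = "act (inv u) (simple_root s)" and ?\<delta> = "act (inv (u \<otimes> t)) (simple_root s)"
  have g: "?\<gamma> \<in> roots" and d: "?\<delta> \<in> roots" using assms by auto
  have "?\<delta> = act t ?\<gamma>"
    using assms by (simp add: inv_mult_group reflection_inv act_mult)
  then have delta: "?\<delta> = (\<lambda>x. ?\<gamma> x - 2 * coxeter_form ?\<gamma> \<beta> * \<beta> x)"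
    using b g \<beta> by (simp add: act_root_reflection)
  define pos where "pos \<gamma> = (if \<gamma> \<in> positive_roots then \<gamma> else (\<lambda>x. - \<gamma> x))" for \<gamma>
  have pos: "pos \<gamma> \<in> positive_roots" "root_reflection (pos \<gamma>) = root_reflection \<gamma>" if "\<gamma> \<in> roots" for \<gamma>
    using that minus_positive_roots[of \<gamma>] root_reflection_minus[of \<gamma>] by (auto simp: pos_def)
  define g' where "g' = pos ?\<gamma>"
  define d' where "d' = pos ?\<delta>"
  have g': "g' \<in> positive_roots" "conj_refl s u = root_reflection g'"
    and d': "d' \<in> positive_roots" "conj_refl s (u \<otimes> t) = root_reflection d'"
    using pos g d assms by (auto simp: conj_refl_root g'_def d'_def)
  have asc: "len u < len (s \<otimes> u) \<longleftrightarrow> ?\<gamma> \<in> positive_roots"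
      "len (u \<otimes> t) < len (s \<otimes> (u \<otimes> t)) \<longleftrightarrow> ?\<delta> \<in> positive_roots"
    using left_ascent_iff[of s u] left_ascent_iff[of s "u \<otimes> t"] assms by auto
  have gb: "g' \<noteq> \<beta>" using assms \<beta> g' by auto
  have db: "d' \<noteq> \<beta>"
  proof
    assume "d' = \<beta>"
    then have "?\<delta> x = (if ?\<delta> \<in> positive_roots then 1 else - 1) * \<beta> x" for x
      by (auto simp: d'_def pos_def)
    then obtain k where "\<And>x. ?\<delta> x = k * \<beta> x" by blast
    then have k: "?\<gamma> x = (k + 2 * coxeter_form ?\<gamma> \<beta>) * \<beta> x" for x
      using fun_cong[OF delta, of x] by (simp add: algebra_simps)
    have "\<exists>k. \<forall>x. g' x = k * \<beta> x"
      using k by (cases "?\<gamma> \<in> positive_roots") (auto simp: g'_def pos_def intro: exI[of _ "- _"])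
    then show False using proportional_roots[OF g'(1) \<beta>(1)] gb by blast
  qed
  \<comment> \<open>The reflection t sends \<open>g'\<close> to \<open>g'\<close> + c \<beta>, which
    is \<open>d'\<close> or its negative according to whether the two signs agree.\<close>
  define c where "c = (if ?\<gamma> \<in> positive_roots then 1 else - 1) * (- 2 * coxeter_form ?\<gamma> \<beta>)"
  show ?thesis
  proof (cases "?\<gamma> \<in> positive_roots \<longleftrightarrow> ?\<delta> \<in> positive_roots")
    case True
    then have eq: "d' x = g' x + c * \<beta> x" for x
      using fun_cong[OF delta, of x] by (auto simp: d'_def g'_def pos_def c_def algebra_simps)
    have "(t, root_reflection g') \<in> r \<longleftrightarrow> (t, root_reflection d') \<in> r"
    proof -
      \<comment> \<open>For c > 0 the root \<open>d'\<close> is between \<open>g'\<close> and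
        \<beta>; for c < 0 the root \<open>g'\<close> is between \<open>d'\<close> and \<beta>.
        Either way both are on the same side of \<beta>.\<close>
      consider "c = 0" | "0 < c" | "c < 0" by linarith
      then show ?thesis
      proof cases
        case 1
        then have "d' = g'" using eq by auto
        then show ?thesis by simp
      next
        case 2
        then show ?thesis
          using reflection_order_between[OF r g'(1) \<beta>(1) gb, of 1 c d'] d'(1) eq \<beta>(2)
            reflection_order_asym[OF r] reflection_orderD(1)[OF r] by (auto dest: transD)
      next
        case 3
        then show ?thesis
          using reflection_order_between[OF r d'(1) \<beta>(1) db, of 1 "-c" g'] g'(1) eq \<beta>(2)
            reflection_order_asym[OF r] reflection_orderD(1)[OF r] by (auto dest: transD)
      qed
    qed
    then show ?thesis using True asc g' d' by auto
  next
    case False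
    \<comment> \<open>Here -c \<beta> = \<open>g'\<close> + \<open>d'\<close> is nonnegative and
      nonzero, so c < 0 and \<beta> itself is the middle root.\<close>
    then have eq: "d' x = - g' x - c * \<beta> x" for x
      using fun_cong[OF delta, of x] by (auto simp: d'_def g'_def pos_def c_def algebra_simps)
    obtain x where "g' x \<noteq> 0" using root_neq_0[of g'] g' positive_rootsD by blast
    moreover have "0 \<le> g' x" "0 \<le> d' x" "0 \<le> \<beta> x" using g' d' \<beta> by (auto simp: positive_roots_def)
    ultimately have "0 < - c * \<beta> x" using eq[of x] by auto
    then have c: "c < 0" using \<open>0 \<le> \<beta> x\<close> by (auto simp: mult_less_0_iff)
    have "g' \<noteq> d'"
    proof
      assume "g' = d'"
      then have "g' x = (- c / 2) * \<beta> x" for x using eq[of x] by auto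
      then show False using proportional_roots[OF g'(1) \<beta>(1)] gb by blast
    qed
    moreover have "\<beta> x = (1 / - c) * g' x + (1 / - c) * d' x" for x
      using eq[of x] c by (simp add: field_simps)
    ultimately have "(t, root_reflection g') \<in> r \<longleftrightarrow> (t, root_reflection d') \<notin> r"
      using reflection_order_between[OF r g'(1) d'(1), of "1 / - c" "1 / - c" \<beta>] c \<beta>
        reflection_order_asym[OF r] reflection_orderD(1)[OF r] by (auto dest: transD)
    then show ?thesis using False asc g' d' by auto
  qed
qed

section \<open>Increasing paths and the recursion for R-polynomials\<close>

lemma down_reflections: "t \<in> down v \<Longrightarrow> t \<in> reflections"
  and down_len: "t \<in> down v \<Longrightarrow> len (v \<otimes> t) < len v"
  by (auto simp: down_def)

lemma bruhat_edge_iff: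
  assumes "v \<in> carrier W"
  shows "bruhat_edge a v \<longleftrightarrow> (\<exists>t\<in>down v. a = v \<otimes> t)"
proof
  assume a: "bruhat_edge a v"
  let ?t = "inv a \<otimes> v"
  have t: "a \<in> carrier W" "?t \<in> reflections" "len a < len v" using a by (auto simp: bruhat_edge_def)
  then have "a \<otimes> ?t = v" using assms by simp
  then have "a = v \<otimes> ?t" using t mult_reflection_cancel[of a ?t] by simp
  moreover have "?t \<in> down v" using t \<open>a = v \<otimes> ?t\<close> by (auto simp: down_def)
  ultimately show "\<exists>t\<in>down v. a = v \<otimes> t" by blast
next
  assume "\<exists>t\<in>down v. a = v \<otimes> t"
  then obtain t where t: "t \<in> down v" "a = v \<otimes> t" by blast
  then have "inv a \<otimes> v = t"
    using assms by (simp add: down_def inv_mult_group reflection_inv m_assoc reflections_closed)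
  then show "bruhat_edge a v" using t assms by (auto simp: bruhat_edge_def down_def)
qed

lemma bruhat_path_le:
  assumes "p \<in> bruhat_paths u v"
  shows "bruhat_le u v"
proof -
  have "bruhat_edge\<^sup>*\<^sup>* (hd p) (last p)" if "p \<noteq> []" "successively bruhat_edge p" for p
    using that by (induction p rule: induct_list012) (auto intro: converse_rtranclp_into_rtranclp)
  moreover have "u \<in> carrier W" using assms hd_in_set[of p] by (auto simp: bruhat_paths_def)
  ultimately show ?thesis using assms by (auto simp: bruhat_paths_def bruhat_le_def)
qed

lemma bruhat_le_len: "bruhat_le u v \<Longrightarrow> u = v \<or> len u < len v"
  using bruhat_edges_len by (auto simp: bruhat_le_def)

lemma bruhat_le_closed: "bruhat_le u v \<Longrightarrow> u \<in> carrier W \<and> v \<in> carrier W"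
  using bruhat_edges_len by (auto simp: bruhat_le_def)

text \<open>Paths are taken apart at their last edge: only finitely many edges enter a vertex,
  although infinitely many may leave it, and the length of the end point decreases.\<close>

lemma bruhat_paths_eq:
  assumes v: "v \<in> carrier W"
  shows "bruhat_paths u v = (if u = v then {[v]} else {}) \<union>
    (\<Union>t\<in>down v. (\<lambda>p. p @ [v]) ` bruhat_paths u (v \<otimes> t))"
proof (intro equalityI subsetI)
  fix p
  assume p: "p \<in> bruhat_paths u v"
  then obtain q where q: "p = q @ [v]" by (auto simp: bruhat_paths_def) (metis append_butlast_last_id)
  show "p \<in> (if u = v then {[v]} else {}) \<union> (\<Union>t\<in>down v. (\<lambda>p. p @ [v]) ` bruhat_paths u (v \<otimes> t))"
  proof (cases "q = []")
    case True
    then show ?thesis using p q by (auto simp: bruhat_paths_def)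
  next
    case False
    then have "bruhat_edge (last q) v" using p q by (auto simp: bruhat_paths_def successively_append_iff)
    then obtain t where t: "t \<in> down v" "last q = v \<otimes> t" using bruhat_edge_iff v by blast
    then have "q \<in> bruhat_paths u (v \<otimes> t)"
      using p q False by (auto simp: bruhat_paths_def successively_append_iff)
    then show ?thesis using t q by blast
  qed
next
  fix p
  assume "p \<in> (if u = v then {[v]} else {}) \<union> (\<Union>t\<in>down v. (\<lambda>p. p @ [v]) ` bruhat_paths u (v \<otimes> t))"
  then consider "u = v" "p = [v]" | t q where "t \<in> down v" "q \<in> bruhat_paths u (v \<otimes> t)" "p = q @ [v]"
    by (auto split: if_splits)
  then show "p \<in> bruhat_paths u v"
  proof cases
    case 1
    then show ?thesis using v by (auto simp: bruhat_paths_def)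
  next
    case 2
    then show ?thesis
      using v bruhat_edge_iff[of v] by (auto simp: bruhat_paths_def successively_append_iff)
  qed
qed

lemma finite_bruhat_paths [simp, intro]: "finite (bruhat_paths u v)"
proof (cases "v \<in> carrier W")
  case True
  then show ?thesis
  proof (induction "len v" arbitrary: v rule: less_induct)
    case less
    then have "finite (bruhat_paths u (v \<otimes> t))" if "t \<in> down v" for t
      using that by (auto simp: down_def)
    then show ?case
      unfolding bruhat_paths_eq[OF less.prems] using less.prems by auto
  qed
next
  case False
  then have "bruhat_paths u v = {}"
    using bruhat_path_le bruhat_le_closed by blast
  then show ?thesis by simp
qed

lemma sum_bruhat_paths:
  assumes v: "v \<in> carrier W"
  shows "(\<Sum>p\<in>bruhat_paths u v. f p) =
    (if u = v then f [v] else 0) + (\<Sum>t\<in>down v. \<Sum>p\<in>bruhat_paths u (v \<otimes> t). f (p @ [v]))"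
    (is "_ = ?a + ?b")
proof -
  let ?A = "if u = v then {[v]} else {}" and ?B = "\<lambda>t. (\<lambda>p. p @ [v]) ` bruhat_paths u (v \<otimes> t)"
  have "?A \<inter> (\<Union>t\<in>down v. ?B t) = {}" by (auto simp: bruhat_paths_def split: if_splits)
  then have "(\<Sum>p\<in>bruhat_paths u v. f p) = sum f ?A + sum f (\<Union>t\<in>down v. ?B t)"
    unfolding bruhat_paths_eq[OF v] using v by (intro sum.union_disjoint) auto
  also have "sum f ?A = ?a" by auto
  also have "sum f (\<Union>t\<in>down v. ?B t) = (\<Sum>t\<in>down v. sum f (?B t))"
  proof (rule sum.UNION_disjoint)
    show "\<forall>t\<in>down v. \<forall>t'\<in>down v. t \<noteq> t' \<longrightarrow> ?B t \<inter> ?B t' = {}"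
    proof (intro ballI impI)
      fix t t'
      assume *: "t \<in> down v" "t' \<in> down v" "t \<noteq> t'"
      then have "v \<otimes> t \<noteq> v \<otimes> t'" using v by (auto dest!: down_reflections reflections_closed)
      then show "?B t \<inter> ?B t' = {}" by (auto simp: bruhat_paths_def)
    qed
  qed (use v in auto)
  also have "\<dots> = ?b"
    by (rule sum.cong[OF refl], subst sum.reindex) (auto simp: inj_on_def)
  finally show ?thesis .
qed

text \<open>Unspecified for a path without edges, hence the side conditions on
  \<open>path_length\<close> wherever it is used.\<close>

definition last_label :: "'a list \<Rightarrow> 'a" where
  "last_label p = inv (last (butlast p)) \<otimes> last p"

lemma path_length_snoc [simp]: "p \<noteq> [] \<Longrightarrow> path_length (p @ [v]) = Suc (path_length p)"
  by (cases p) (auto simp: path_length_def)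

lemma bruhat_paths_nonempty: "p \<in> bruhat_paths u v \<Longrightarrow> p \<noteq> []"
  by (auto simp: bruhat_paths_def)

lemma last_label_snoc:
  assumes "v \<in> carrier W" "t \<in> down v" "p \<in> bruhat_paths u (v \<otimes> t)"
  shows "last_label (p @ [v]) = t"
proof -
  have "last p = v \<otimes> t" using assms by (auto simp: bruhat_paths_def)
  then show ?thesis
    using assms down_reflections[OF assms(2)]
    by (simp add: last_label_def inv_mult_group reflection_inv m_assoc reflections_closed)
qed

lemma last_label_down:
  assumes "v \<in> carrier W" "p \<in> bruhat_paths u v" "path_length p \<noteq> 0"
  shows "last_label p \<in> down v"
proof -
  from assms(2,3) obtain t q where *: "t \<in> down v" "q \<in> bruhat_paths u (v \<otimes> t)" "p = q @ [v]"
    unfolding bruhat_paths_eq[OF assms(1)] by (auto simp: path_length_def split: if_splits)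
  then have "last_label p = t" using last_label_snoc[OF assms(1)] by simp
  then show ?thesis using * by simp
qed

text \<open>The only new candidate for a descent is the former end point, which becomes an interior
  vertex exactly if the old path has an edge.\<close>

lemma des_snoc:
  assumes "v \<in> carrier W" "t \<in> down v" "p \<in> bruhat_paths u (v \<otimes> t)"
  shows "des r (p @ [v]) = des r p + (if path_length p \<noteq> 0 \<and> (t, last_label p) \<in> r then 1 else 0)"
proof -
  let ?D = "\<lambda>p i. (inv (p ! i) \<otimes> p ! (i + 1), inv (p ! (i - 1)) \<otimes> p ! i) \<in> r"
  have p: "p \<noteq> []" "last p = v \<otimes> t" using assms by (auto simp: bruhat_paths_def)
  have eq: "{i \<in> {1..<path_length (p @ [v])}. ?D (p @ [v]) i} =
    {i \<in> {1..<path_length p}. ?D p i} \<union>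
      (if path_length p \<noteq> 0 \<and> (t, last_label p) \<in> r then {path_length p} else {})" (is "?X = ?Y")
  proof (rule Set.set_eqI)
    fix i
    consider "i < path_length p" | "i = path_length p" | "i > path_length p" by linarith
    then show "i \<in> ?X \<longleftrightarrow> i \<in> ?Y"
    proof cases
      case 1
      then show ?thesis using p by (auto simp: nth_append path_length_def)
    next
      case 2
      have "inv ((p @ [v]) ! i) \<otimes> (p @ [v]) ! (i + 1) = t"
        using last_label_snoc[OF assms] 2 p
        by (simp add: last_label_def nth_append path_length_def last_conv_nth)
      moreover have "inv ((p @ [v]) ! (i - 1)) \<otimes> (p @ [v]) ! i = last_label p" if "path_length p \<noteq> 0"
      proof -
        from p obtain q x where q: "p = q @ [x]" by (cases p rule: rev_cases) auto
        with that have "q \<noteq> []" by (auto simp: path_length_def)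
        then show ?thesis using 2 q by (auto simp: last_label_def nth_append path_length_def last_conv_nth)
      qed
      ultimately show ?thesis using 2 p by auto
    next
      case 3
      then show ?thesis using p by auto
    qed
  qed
  show ?thesis unfolding des_def eq by (auto simp: card_insert_if)
qed

section \<open>Generating functions of increasing paths\<close>

definition q_var :: "int poly" where
  "q_var = [:0, 1:]"

lemma monom_Suc_q_var: "monom 1 (Suc n) = q_var * monom 1 n"
  by (simp add: q_var_def monom_Suc)

text \<open>The last label of an increasing path is its largest. For an initial section L the
  condition on it therefore confines all labels of the path to L.\<close>

definition incr_sum :: "('a \<times> 'a) set \<Rightarrow> 'a set \<Rightarrow> 'a \<Rightarrow> 'a \<Rightarrow> int poly" where
  "incr_sum r L u v = (\<Sum>p\<in>bruhat_paths u v.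
    if des r p = 0 \<and> (path_length p = 0 \<or> last_label p \<in> L) then monom 1 (path_length p) else 0)"

abbreviation below :: "('a \<times> 'a) set \<Rightarrow> 'a \<Rightarrow> 'a set" where
  "below r t \<equiv> {t'. (t', t) \<in> r}"

lemma des_trivial [simp]: "des r [v] = 0" "path_length [v] = 0"
  by (simp_all add: des_def path_length_def)

text \<open>Consecutive labels are distinct, because repeating t would lead from
  \<open>v \<otimes> t\<close> back to v. So a step that is not a descent is an ascent.\<close>

lemma last_label_order:
  assumes r: "reflection_order r" and "v \<in> carrier W" "t \<in> down v" "p \<in> bruhat_paths u (v \<otimes> t)"
    "path_length p \<noteq> 0"
  shows "(t, last_label p) \<notin> r \<longleftrightarrow> (last_label p, t) \<in> r"
proof -
  have t: "t \<in> reflections" "len (v \<otimes> t) < len v" using assms by (auto simp: down_def)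
  then have l: "last_label p \<in> down (v \<otimes> t)" using assms by (intro last_label_down[of _ _ u]) auto
  then have "last_label p \<noteq> t" using t assms by (auto simp: down_def)
  then show ?thesis
    using reflection_orderD(3)[OF r] reflection_order_asym[OF r] t l
    unfolding total_on_def by (meson down_reflections)
qed

lemma incr_sum_rec:
  assumes r: "reflection_order r" and v: "v \<in> carrier W"
  shows "incr_sum r L u v = (if u = v then 1 else 0) +
    (\<Sum>t\<in>down v \<inter> L. q_var * incr_sum r (below r t) u (v \<otimes> t))"
proof -
  let ?f = "\<lambda>L p. if des r p = 0 \<and> (path_length p = 0 \<or> last_label p \<in> L)
    then monom 1 (path_length p) else (0 :: int poly)"
  have "(\<Sum>p\<in>bruhat_paths u (v \<otimes> t). ?f L (p @ [v])) =
      (if t \<in> L then q_var * incr_sum r (below r t) u (v \<otimes> t) else 0)" if t: "t \<in> down v" for t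
  proof -
    have "?f L (p @ [v]) = (if t \<in> L then q_var * ?f (below r t) p else 0)"
      if p: "p \<in> bruhat_paths u (v \<otimes> t)" for p
      using last_label_order[OF r v t p] bruhat_paths_nonempty[OF p]
      by (auto simp: last_label_snoc[OF v t p] des_snoc[OF v t p] monom_Suc_q_var)
    then show ?thesis by (simp add: incr_sum_def sum_distrib_left)
  qed
  then show ?thesis
    unfolding incr_sum_def[of r L] sum_bruhat_paths[OF v]
    using v by (simp add: sum.inter_restrict)
qed

lemma conj_refl_mult_reflection:
  assumes "s \<in> S" "v \<in> carrier W" "t \<in> reflections"
  shows "conj_refl s (v \<otimes> t) = t \<otimes> conj_refl s v \<otimes> t"
  using assms by (simp add: conj_refl_def inv_mult_group reflection_inv m_assoc reflections_closed)

lemma down_generator_mult: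
  assumes "s \<in> S" "v \<in> carrier W"
  shows "down (s \<otimes> v) - {conj_refl s v} = down v - {conj_refl s v}"
proof -
  have "t \<in> down (s \<otimes> v) \<longleftrightarrow> t \<in> down v" if "t \<noteq> conj_refl s v" "t \<in> reflections" for t
    using left_mult_edge[OF assms that(2,1)] len_mult_reflection_neq[of v t]
      len_mult_reflection_neq[of "s \<otimes> v" t] that assms by (auto simp: down_def)
  then show ?thesis using down_reflections by blast
qed

lemma conj_refl_in_down:
  assumes "s \<in> S" "v \<in> carrier W"
  shows "conj_refl s v \<in> down v \<longleftrightarrow> len (s \<otimes> v) < len v"
  using assms by (auto simp: down_def mult_conj_refl)

text \<open>
  The left recursion is the case where \<open>L\<close> contains all reflections and \<open>s\<close> is a left descent of \<open>v\<close>.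
  The induction removes the last edge, whose label becomes the new bound on labels, so it needs all
  initial sections \<open>L\<close>.
\<close>

lemma incr_sum_left_mult:
  assumes r: "reflection_order r" and s: "s \<in> S" and u: "u \<in> carrier W" "len u < len (s \<otimes> u)"
    and v: "v \<in> carrier W" and L: "\<And>t t'. t \<in> L \<Longrightarrow> (t', t) \<in> r \<Longrightarrow> t' \<in> L"
  shows "incr_sum r L u v = incr_sum r L (s \<otimes> u) (s \<otimes> v) +
    (if len (s \<otimes> v) < len v \<longleftrightarrow> conj_refl s v \<in> L then q_var * incr_sum r L u (s \<otimes> v) else 0)"
  using v L
proof (induction "len v + len (s \<otimes> v)" arbitrary: v L rule: less_induct)
  case less
  note v = \<open>v \<in> carrier W\<close> and L = less.prems(2)
  have sc: "s \<in> carrier W" using s by simp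
  note tr = transD[OF reflection_orderD(1)[OF r]] and asym = reflection_order_asym[OF r]
  define \<tau> where "\<tau> = conj_refl s v"
  have tau: "\<tau> \<in> reflections" "v \<otimes> \<tau> = s \<otimes> v" "s \<otimes> v \<otimes> \<tau> = v"
    using s v mult_conj_refl[of s v] mult_conj_refl[of s "s \<otimes> v"] by (auto simp: \<tau>_def)
  define E where "E = down v - {\<tau>}"
  have E: "finite E" "E = down (s \<otimes> v) - {\<tau>}" using down_generator_mult[OF s v] v by (auto simp: E_def \<tau>_def)
  let ?q = "q_var"
  \<comment> \<open>What remains when an edge labelled t is removed: the unprimed sums start at u
    and the primed ones at \<open>s \<otimes> u\<close>; G and \<open>K'\<close> end at
    \<open>v \<otimes> t\<close>, while \<open>G'\<close> and K end at
    \<open>s \<otimes> (v \<otimes> t)\<close>.\<close>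
  define G where "G t = incr_sum r (below r t) u (v \<otimes> t)" for t
  define G' where "G' t = incr_sum r (below r t) (s \<otimes> u) (s \<otimes> (v \<otimes> t))" for t
  define K where "K t = incr_sum r (below r t) u (s \<otimes> (v \<otimes> t))" for t
  define K' where "K' t = incr_sum r (below r t) (s \<otimes> u) (v \<otimes> t)" for t
  \<comment> \<open>For labels t in E, the sign rule turns this into the condition for a correction
    term at \<open>v \<otimes> t\<close> with bound t, but expressed at v.\<close>
  define P where "P t \<longleftrightarrow> (len (s \<otimes> v) < len v \<longleftrightarrow> (\<tau>, t) \<in> r)" for t
  have tot: "(t, \<tau>) \<in> r \<longleftrightarrow> (\<tau>, t) \<notin> r" if "t \<in> E" for t
    using that reflection_orderD(3)[OF r] asym tau down_reflections[of t]
    unfolding total_on_def E_def by blast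
  have IH: "G t = G' t + (if P t then ?q * K t else 0)" "P t \<Longrightarrow> K t = K' t" if t: "t \<in> E" for t
  proof -
    have t': "t \<in> reflections" "t \<noteq> \<tau>" "len (v \<otimes> t) < len v" "len (s \<otimes> v \<otimes> t) < len (s \<otimes> v)"
      using t E by (auto simp: E_def down_def)
    then have tc: "t \<in> carrier W" by auto
    let ?\<tau>' = "conj_refl s (v \<otimes> t)"
    have "?\<tau>' \<noteq> t"
    proof
      assume "?\<tau>' = t"
      then have "t \<otimes> (t \<otimes> \<tau> \<otimes> t) = t \<otimes> t"
        using conj_refl_mult_reflection[OF s v t'(1)] by (simp add: \<tau>_def)
      then have "\<tau> \<otimes> t = \<one>"
        using t' tau tc reflections_closed[OF tau(1)] by (simp add: reflection_square flip: m_assoc)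
      then have "\<tau> = t" using reflection_inv[OF t'(1)] inv_equality[of \<tau> t] tc tau by auto
      then show False using t' by simp
    qed
    then have "(t, ?\<tau>') \<in> r \<longleftrightarrow> (?\<tau>', t) \<notin> r"
      using reflection_orderD(3)[OF r] asym t' s v unfolding total_on_def by blast
    then have P1: "(len (s \<otimes> (v \<otimes> t)) < len (v \<otimes> t) \<longleftrightarrow> ?\<tau>' \<in> below r t) \<longleftrightarrow> P t"
      using left_ascent_sign_rule[OF r s v t'(1)] t' tot[OF t] len_generator_mult[of v s]
        len_generator_mult[of "v \<otimes> t" s] s v tc unfolding P_def \<tau>_def by auto
    have less1: "len (v \<otimes> t) + len (s \<otimes> (v \<otimes> t)) < len v + len (s \<otimes> v)"
      using t' tc v sc by (simp add: m_assoc)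
    show "G t = G' t + (if P t then ?q * K t else 0)"
      using less.hyps[of "v \<otimes> t" "below r t"] less1 v tc P1 tr
      unfolding G_def G'_def K_def by auto
    \<comment> \<open>The induction hypothesis at \<open>s \<otimes> (v \<otimes> t)\<close>:
      exchanging the two end points reverses the length comparison, so the correction term vanishes
      exactly when it is present at \<open>v \<otimes> t\<close>.\<close>
    show "K t = K' t" if "P t"
    proof -
      have "\<not> (len (v \<otimes> t) < len (s \<otimes> (v \<otimes> t)) \<longleftrightarrow> ?\<tau>' \<in> below r t)"
        using P1 that len_generator_mult[of "v \<otimes> t" s] s v tc by auto
      moreover have cl: "s \<otimes> (v \<otimes> t) \<in> carrier W" using v tc sc by simp
      moreover have ss: "s \<otimes> (s \<otimes> (v \<otimes> t)) = v \<otimes> t" using v tc s by simp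
      moreover have "\<And>t1 t2. t1 \<in> below r t \<Longrightarrow> (t2, t1) \<in> r \<Longrightarrow> t2 \<in> below r t" using tr by blast
      ultimately show ?thesis
        using less.hyps[of "s \<otimes> (v \<otimes> t)" "below r t", unfolded ss] less1 v tc s
        by (simp add: K_def K'_def add.commute)
    qed
  qed
  have sum_G: "(\<Sum>t\<in>E \<inter> L. ?q * G t) = (\<Sum>t\<in>E \<inter> L. ?q * G' t) + ?q * (\<Sum>t\<in>{t\<in>E \<inter> L. P t}. ?q * K t)"
  proof -
    have "(\<Sum>t\<in>E \<inter> L. ?q * G t) = (\<Sum>t\<in>E \<inter> L. ?q * G' t + (if P t then ?q * (?q * K t) else 0))"
      by (intro sum.cong refl) (simp add: IH(1) distrib_left)
    also have "\<dots> = (\<Sum>t\<in>E \<inter> L. ?q * G' t) + (\<Sum>t\<in>{t\<in>E \<inter> L. P t}. ?q * (?q * K t))"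
      using sum.inter_filter[of "E \<inter> L" "\<lambda>t. ?q * (?q * K t)" P] E(1) by (simp add: sum.distrib)
    finally show ?thesis by (simp add: sum_distrib_left)
  qed
  have cancel: "s \<otimes> u = s \<otimes> v \<longleftrightarrow> u = v" using u v sc by simp
  have rec_E: "incr_sum r M a v = (if a = v then 1 else 0) +
      (\<Sum>t\<in>E \<inter> M. ?q * incr_sum r (below r t) a (v \<otimes> t)) +
      (if len (s \<otimes> v) < len v \<and> \<tau> \<in> M then ?q * incr_sum r (below r \<tau>) a (s \<otimes> v) else 0)" for M a
  proof -
    have *: "down v \<inter> M = E \<inter> M \<union> (if len (s \<otimes> v) < len v \<and> \<tau> \<in> M then {\<tau>} else {})"
      using conj_refl_in_down[OF s v] by (auto simp: E_def \<tau>_def)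
    have "\<tau> \<notin> E" by (simp add: E_def)
    then show ?thesis unfolding incr_sum_rec[OF r v, of M] * using E(1) tau by (auto simp: algebra_simps)
  qed
  have rec_sE: "incr_sum r M a (s \<otimes> v) = (if a = s \<otimes> v then 1 else 0) +
      (\<Sum>t\<in>E \<inter> M. ?q * incr_sum r (below r t) a (s \<otimes> (v \<otimes> t))) +
      (if len v < len (s \<otimes> v) \<and> \<tau> \<in> M then ?q * incr_sum r (below r \<tau>) a v else 0)" for M a
  proof -
    have svc: "s \<otimes> v \<in> carrier W" using sc v by simp
    have *: "down (s \<otimes> v) \<inter> M = E \<inter> M \<union> (if len v < len (s \<otimes> v) \<and> \<tau> \<in> M then {\<tau>} else {})"
      using conj_refl_in_down[OF s svc] E(2) s v by (auto simp: \<tau>_def)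
    have "\<tau> \<notin> E" by (simp add: E_def)
    moreover have "s \<otimes> v \<otimes> t = s \<otimes> (v \<otimes> t)" if "t \<in> E" for t
      using that v sc down_reflections[of t v] by (auto simp: E_def m_assoc reflections_closed)
    ultimately show ?thesis
      unfolding incr_sum_rec[OF r svc, of M] * using E(1) tau by (auto simp: algebra_simps)
  qed
  show ?case
  proof (cases "len (s \<otimes> v) < len v")
    case desc: True
    show ?thesis
    proof (cases "\<tau> \<in> L")
      case True
      \<comment> \<open>Both parts make up the correction q times the sum from u to
        \<open>s \<otimes> v\<close>: labels above \<tau> come from the induction hypothesis, labels
        below \<tau> from paths whose last edge is the one from \<open>s \<otimes> v\<close> to
        v.\<close>
      have split: "E \<inter> L = {t\<in>E \<inter> L. P t} \<union> E \<inter> below r \<tau>"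
        using tot True L desc by (auto simp: P_def)
      have "(\<Sum>t\<in>E \<inter> L. ?q * K t) = (\<Sum>t\<in>{t\<in>E \<inter> L. P t} \<union> E \<inter> below r \<tau>. ?q * K t)"
        by (rule sum.cong[OF split refl])
      also have "\<dots> = (\<Sum>t\<in>{t\<in>E \<inter> L. P t}. ?q * K t) + (\<Sum>t\<in>E \<inter> below r \<tau>. ?q * K t)"
        using tot desc E(1) by (intro sum.union_disjoint) (auto simp: P_def)
      finally show ?thesis
        unfolding rec_E[of L u] rec_sE[of _ u] rec_sE[of _ "s \<otimes> u"]
        using sum_G desc True
        by (simp add: cancel flip: \<tau>_def G_def G'_def K_def) (simp add: algebra_simps)
    next
      case False
      \<comment> \<open>An initial section without \<tau> contains only labels of E below \<tau>,
        and for a left descent none of these satisfies P.\<close>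
      then have empty: "{t\<in>E \<inter> L. P t} = {}" using L desc by (auto simp: P_def)
      then show ?thesis
        unfolding rec_E[of L u] rec_sE[of _ "s \<otimes> u"]
        using sum_G[unfolded empty] desc False by (simp add: cancel flip: \<tau>_def G_def G'_def K_def)
    qed
  next
    case False
    then have asc: "len v < len (s \<otimes> v)" using len_generator_mult[of v s] s v by auto
    have P_eq: "P t \<longleftrightarrow> (t, \<tau>) \<in> r" if "t \<in> E" for t using tot[OF that] False by (auto simp: P_def)
    have neq: "s \<otimes> u \<noteq> v" "u \<noteq> s \<otimes> v" using u v s asc by auto
    show ?thesis
    proof (cases "\<tau> \<in> L")
      case True
      \<comment> \<open>The extra terms now match the paths from \<open>s \<otimes> u\<close> that
        end with the edge from v to \<open>s \<otimes> v\<close>; the two descriptions agree because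
        K and \<open>K'\<close> coincide on these labels.\<close>
      have eq: "{t\<in>E \<inter> L. P t} = E \<inter> below r \<tau>" using P_eq L True by auto
      have "(\<Sum>t\<in>E \<inter> below r \<tau>. ?q * K t) = (\<Sum>t\<in>E \<inter> below r \<tau>. ?q * K' t)"
        by (intro sum.cong refl) (use IH(2) P_eq in auto)
      then show ?thesis
        unfolding rec_E[of L u] rec_E[of _ "s \<otimes> u"] rec_sE[of L "s \<otimes> u"]
        using sum_G[unfolded eq] asc True neq by (simp add: cancel flip: \<tau>_def G_def G'_def K_def K'_def)
    next
      case F: False
      have eq: "{t\<in>E \<inter> L. P t} = E \<inter> L" using P_eq tot L F by auto
      then show ?thesis
        unfolding rec_E[of L u] rec_sE[of L "s \<otimes> u"] rec_sE[of L u]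
        using sum_G[unfolded eq] asc F neq by (simp add: cancel flip: \<tau>_def G_def G'_def K_def)
    qed
  qed
qed

section \<open>From the left recursion to the right recursion\<close>

definition R_tilde :: "('a \<times> 'a) set \<Rightarrow> 'a \<Rightarrow> 'a \<Rightarrow> int poly" where
  "R_tilde r = incr_sum r reflections"

text \<open>One step of the recursion as an operator on functions of the lower element, so that left
  and right steps can be interchanged without mentioning v.\<close>

definition left_op :: "'a \<Rightarrow> ('a \<Rightarrow> int poly) \<Rightarrow> 'a \<Rightarrow> int poly" where
  "left_op s f u = f (s \<otimes> u) + (if len u < len (s \<otimes> u) then q_var * f u else 0)"

definition right_op :: "'a \<Rightarrow> ('a \<Rightarrow> int poly) \<Rightarrow> 'a \<Rightarrow> int poly" where
  "right_op s f u = f (u \<otimes> s) + (if len u < len (u \<otimes> s) then q_var * f u else 0)"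

lemma R_tilde_left:
  assumes r: "reflection_order r" and s: "s \<in> S" and u: "u \<in> carrier W"
    and v: "v \<in> carrier W" "len (s \<otimes> v) < len v"
  shows "R_tilde r u v = left_op s (\<lambda>w. R_tilde r w (s \<otimes> v)) u"
proof -
  have L: "\<And>t t'. t \<in> reflections \<Longrightarrow> (t', t) \<in> r \<Longrightarrow> t' \<in> reflections"
    using reflection_orderD(4)[OF r] by auto
  show ?thesis
  proof (cases "len u < len (s \<otimes> u)")
    case True
    then show ?thesis
      using incr_sum_left_mult[OF r s u True v(1) L] v s by (simp add: R_tilde_def left_op_def)
  next
    \<comment> \<open>The recursion at \<open>s \<otimes> u\<close> and
      \<open>s \<otimes> v\<close>, read backwards; passing up from \<open>s \<otimes> v\<close> to
      v gives no correction term.\<close>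
    case False
    then have "len (s \<otimes> u) < len u" using len_generator_mult[of u s] u s by auto
    then show ?thesis
      using incr_sum_left_mult[OF r s _ _ _ L, of "s \<otimes> u" "s \<otimes> v"] u v s
      by (simp add: R_tilde_def left_op_def)
  qed
qed

text \<open>In the square formed by u, \<open>s \<otimes> u\<close>, \<open>u \<otimes> t\<close>
  and \<open>s \<otimes> u \<otimes> t\<close>, opposite sides have the same orientation. The
  exception is the degenerate square with \<open>s \<otimes> u = u \<otimes> t\<close>, on which
  both operators agree.\<close>

lemma left_op_right_op_commute:
  assumes "s \<in> S" "t \<in> S" "u \<in> carrier W"
  shows "left_op s (right_op t f) u = right_op t (left_op s f) u"
proof -
  have c: "s \<in> carrier W" "t \<in> carrier W" using assms by auto
  have a: "s \<otimes> (u \<otimes> t) = s \<otimes> u \<otimes> t" using assms by (simp add: m_assoc)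
  show ?thesis
  proof (cases "s \<otimes> u = u \<otimes> t")
    case True
    then have "s \<otimes> u \<otimes> t = u" using assms by simp
    then show ?thesis by (simp add: left_op_def right_op_def a True)
  next
    case False
    then have ne: "t \<noteq> conj_refl s u" using assms mult_conj_refl[of s u] by auto
    have "t \<in> reflections" unfolding reflections_def
      by (rule CollectI, rule exI[of _ "\<one>"], rule exI[of _ t]) (use assms in simp)
    then have e1: "len u < len (u \<otimes> t) \<longleftrightarrow> len (s \<otimes> u) < len (s \<otimes> u \<otimes> t)"
      using left_mult_edge[OF assms(1,3)] ne by blast
    then have e2: "len u < len (s \<otimes> u) \<longleftrightarrow> len (u \<otimes> t) < len (s \<otimes> u \<otimes> t)"
      using len_mult_generator[of u t] len_mult_generator[of "s \<otimes> u" t]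
        len_generator_mult[of u s] len_generator_mult[of "u \<otimes> t" s] assms a by auto
    show ?thesis by (simp add: left_op_def right_op_def a e1 e2 algebra_simps)
  qed
qed

lemma R_tilde_one:
  assumes r: "reflection_order r"
  shows "R_tilde r u \<one> = (if u = \<one> then 1 else 0)"
  unfolding R_tilde_def by (subst incr_sum_rec[OF r]) (auto simp: down_def)

lemma len_generator [simp]: "s \<in> S \<Longrightarrow> len s = 1"
  using len_mult_generator[of \<one> s] by simp

lemma right_op_cong:
  "(\<And>w. w \<in> carrier W \<Longrightarrow> f w = g w) \<Longrightarrow> u \<in> carrier W \<Longrightarrow> s \<in> S \<Longrightarrow> right_op s f u = right_op s g u"
  by (simp add: right_op_def)

lemma left_op_cong:
  "(\<And>w. w \<in> carrier W \<Longrightarrow> f w = g w) \<Longrightarrow> u \<in> carrier W \<Longrightarrow> s \<in> S \<Longrightarrow> left_op s f u = left_op s g u"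
  by (simp add: left_op_def)

text \<open>A left descent t of \<open>v \<otimes> s\<close> allows v to be reduced on the left. The
  induction hypothesis at \<open>t \<otimes> v\<close> supplies the right step, and after commuting
  the operators the left step is undone at \<open>v \<otimes> s\<close>. The base case is v =
  s.\<close>

lemma R_tilde_right:
  assumes r: "reflection_order r" and s: "s \<in> S" and u: "u \<in> carrier W"
    and v: "v \<in> carrier W" "len (v \<otimes> s) < len v"
  shows "R_tilde r u v = right_op s (\<lambda>w. R_tilde r w (v \<otimes> s)) u"
  using u v
proof (induction "len v" arbitrary: u v rule: less_induct)
  case less
  note v = less.prems(2,3)
  show ?case
  proof (cases "v \<otimes> s = \<one>")
    case True
    then have "v = s" using v s mult_generator_cancel[of v s] by simp
    have "s \<otimes> u = \<one> \<longleftrightarrow> u \<otimes> s = \<one>"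
      using less.prems(1) s by (metis generator_carrier inv_comm)
    then show ?thesis
      using R_tilde_left[OF r s less.prems(1) v(1)] s less.prems(1)
      by (auto simp: \<open>v = s\<close> generator_square left_op_def right_op_def R_tilde_one[OF r])
  next
    case False
    then have "0 < len (inv (v \<otimes> s))" using v s len_eq_0[of "v \<otimes> s"] len_inv[of "v \<otimes> s"] by auto
    then obtain t where t: "t \<in> S" "len (inv (v \<otimes> s) \<otimes> t) < len (inv (v \<otimes> s))"
      using ex_right_descent[of "inv (v \<otimes> s)"] v s by auto
    then have tvs: "len (t \<otimes> (v \<otimes> s)) < len (v \<otimes> s)"
      using v s len_inv[of "t \<otimes> (v \<otimes> s)"] by (simp add: inv_mult_group[of t "v \<otimes> s"] generator_inv)
    let ?w = "t \<otimes> v"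
    have w: "?w \<in> carrier W" "?w \<otimes> s = t \<otimes> (v \<otimes> s)" using v s t by (auto simp: m_assoc)
    \<comment> \<open>Going from v through \<open>v \<otimes> s\<close> to
      \<open>t \<otimes> (v \<otimes> s)\<close> lowers the length by 2. Each generator changes it
      by 1, so the route through \<open>t \<otimes> v\<close> descends twice as well.\<close>
    have l: "len ?w < len v" "len (?w \<otimes> s) < len ?w"
    proof -
      have c: "v \<otimes> s \<in> carrier W" using v s by simp
      have "len v = Suc (len (v \<otimes> s))" using len_mult_generator[OF v(1) s] v(2) by linarith
      moreover have "len (v \<otimes> s) = Suc (len (?w \<otimes> s))"
        using len_generator_mult[OF c t(1)] tvs unfolding w(2) by linarith
      moreover note len_generator_mult[OF v(1) t(1)] len_mult_generator[OF w(1) s]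
      ultimately show "len ?w < len v" "len (?w \<otimes> s) < len ?w" by linarith+
    qed
    have "R_tilde r u v = left_op t (\<lambda>x. R_tilde r x ?w) u"
      using R_tilde_left[OF r t(1) less.prems(1) v(1)] l by simp
    also have "\<dots> = left_op t (right_op s (\<lambda>x. R_tilde r x (?w \<otimes> s))) u"
      by (rule left_op_cong) (use less.hyps[OF l(1)] l w less.prems t in auto)
    also have "\<dots> = right_op s (left_op t (\<lambda>x. R_tilde r x (?w \<otimes> s))) u"
      using s t less.prems by (intro left_op_right_op_commute)
    also have "\<dots> = right_op s (\<lambda>x. R_tilde r x (v \<otimes> s)) u"
      by (rule right_op_cong) (use R_tilde_left[OF r t(1)] tvs w v s less.prems in auto)
    finally show ?thesis .
  qed
qed

end

section \<open>Dyer's formula\<close>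

text \<open>
  \<open>q_subst n\<close> is the linear map \<open>q\<^sup>i \<mapsto> x\<^bsup>(n - i) / 2\<^esup> (x - 1)\<^sup>i\<close>, i.e. \<open>p \<mapsto> x\<^bsup>n / 2\<^esup> p(x\<^bsup>1 / 2\<^esup> - x\<^bsup>- 1 / 2\<^esup>)\<close>
  on polynomials of degree at most \<open>n\<close> with the parity of \<open>n\<close>.
\<close>

definition q_subst :: "nat \<Rightarrow> int poly \<Rightarrow> int poly" where
  "q_subst n p = (\<Sum>i\<le>n. smult (coeff p i) (monom 1 ((n - i) div 2) * [:-1, 1:] ^ i))"

lemma q_subst_0 [simp]: "q_subst n 0 = 0"
  by (simp add: q_subst_def)

lemma q_subst_add: "q_subst n (p + p') = q_subst n p + q_subst n p'"
  by (simp add: q_subst_def smult_add_left sum.distrib)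

lemma q_subst_sum: "q_subst n (\<Sum>x\<in>A. f x) = (\<Sum>x\<in>A. q_subst n (f x))"
  by (induction A rule: infinite_finite_induct) (simp_all add: q_subst_add)

lemma q_subst_monom: "k \<le> n \<Longrightarrow> q_subst n (monom 1 k) = monom 1 ((n - k) div 2) * [:-1, 1:] ^ k"
  unfolding q_subst_def
  by (subst sum.remove[of _ k]) (auto intro!: sum.neutral)

text \<open>One more unit of n is a factor x^(1/2), and multiplying it by q = x^(1/2) - x^(-1/2)
  gives x - 1.\<close>

lemma q_subst_Suc: "q_subst (Suc n) ([:0, 1:] * p) = [:-1, 1:] * q_subst n p"
proof -
  have "q_subst (Suc n) ([:0, 1:] * p) =
      (\<Sum>i\<le>n. smult (coeff p i) (monom 1 ((n - i) div 2) * [:-1, 1:] ^ Suc i))"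
    unfolding q_subst_def by (subst sum.atMost_Suc_shift) simp
  also have "\<dots> = [:-1, 1:] * q_subst n p"
    unfolding q_subst_def sum_distrib_left by (intro sum.cong refl) (simp only: mult_smult_right power_Suc mult.left_commute)
  finally show ?thesis .
qed

text \<open>Two more units of n are a factor x. The degree bound removes the summands for n + 1 and
  n + 2, which occur on the left only.\<close>

lemma q_subst_Suc_Suc:
  assumes "degree p \<le> n"
  shows "q_subst (Suc (Suc n)) p = [:0, 1:] * q_subst n p"
proof -
  have "q_subst (Suc (Suc n)) p =
      (\<Sum>i\<le>n. smult (coeff p i) (monom 1 ((Suc (Suc n) - i) div 2) * [:-1, 1:] ^ i))"
    using assms by (simp add: q_subst_def coeff_eq_0)
  also have "\<dots> = (\<Sum>i\<le>n. [:0, 1:] * smult (coeff p i) (monom 1 ((n - i) div 2) * [:-1, 1:] ^ i))"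
  proof (intro sum.cong refl)
    fix i
    assume "i \<in> {..n}"
    then have "(Suc (Suc n) - i) div 2 = Suc ((n - i) div 2)" by (simp add: Suc_diff_le)
    then have "monom 1 ((Suc (Suc n) - i) div 2) = [:0, 1:] * (monom 1 ((n - i) div 2) :: int poly)"
      by (simp add: monom_Suc)
    then show "smult (coeff p i) (monom 1 ((Suc (Suc n) - i) div 2) * [:-1, 1:] ^ i) =
        [:0, 1:] * smult (coeff p i) (monom 1 ((n - i) div 2) * [:-1, 1:] ^ i)"
      by (simp only: mult_smult_right mult.assoc)
  qed
  finally show ?thesis by (simp add: q_subst_def sum_distrib_left)
qed

context coxeter_system
begin

lemma R_tilde_eq_sum:
  assumes "reflection_order r"
  shows "R_tilde r u v = (\<Sum>p\<in>bruhat_paths u v. if des r p = 0 then monom 1 (path_length p) else 0)"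
  unfolding R_tilde_def incr_sum_def
proof (rule sum.cong[OF refl])
  fix p
  assume p: "p \<in> bruhat_paths u v"
  then have "v \<in> carrier W" using bruhat_path_le bruhat_le_closed by blast
  then have "path_length p \<noteq> 0 \<Longrightarrow> last_label p \<in> reflections"
    using p last_label_down down_reflections by blast
  then show "(if des r p = 0 \<and> (path_length p = 0 \<or> last_label p \<in> reflections)
      then monom 1 (path_length p) else 0) = (if des r p = 0 then monom 1 (path_length p) else (0 :: int poly))"
    by auto
qed

lemma R_tilde_eq_0:
  assumes "\<not> bruhat_le u v"
  shows "R_tilde r u v = 0"
proof -
  have "bruhat_paths u v = {}" using assms bruhat_path_le by blast
  then show ?thesis by (simp add: R_tilde_def incr_sum_def)
qed

lemma bruhat_paths_self:
  assumes "v \<in> carrier W"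
  shows "bruhat_paths v v = {[v]}"
proof -
  have "bruhat_paths v (v \<otimes> t) = {}" if "t \<in> down v" for t
    using that bruhat_path_le[of _ v "v \<otimes> t"] bruhat_le_len[of v "v \<otimes> t"] by (force simp: down_def)
  then show ?thesis using bruhat_paths_eq[OF assms, of v] by auto
qed

lemma degree_R_tilde: "reflection_order r \<Longrightarrow> degree (R_tilde r u v) \<le> rank_diff u v"
  by (auto simp: R_tilde_eq_sum intro!: degree_sum_le order_trans[OF degree_monom_le] bruhat_path_length(1))

text \<open>\<open>R_tilde_right\<close> holds for every right descent, in particular for the one
  chosen in \<open>R_poly\<close>. The factors x and x - 1 of that recursion account for rank
  differences dropping by 2 and by 1.\<close>

lemma R_poly_eq_R_tilde:
  assumes r: "reflection_order r" and "u \<in> carrier W" "v \<in> carrier W"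
  shows "R_poly u v = q_subst (rank_diff u v) (R_tilde r u v)"
  using assms(2,3)
proof (induction "len v" arbitrary: u v rule: less_induct)
  case less
  note u = less.prems(1) and v = less.prems(2)
  consider "\<not> bruhat_le u v" | "u = v" | "bruhat_le u v" "u \<noteq> v" by blast
  then show ?case
  proof cases
    case 1
    then show ?thesis by (simp add: R_poly.simps[of u v] R_tilde_eq_0)
  next
    case 2
    then have "R_poly u v = 1" using v by (simp add: R_poly.simps[of v v] bruhat_le_def)
    moreover have "R_tilde r u v = 1"
      using 2 v by (simp add: R_tilde_eq_sum[OF r] bruhat_paths_self)
    ultimately show ?thesis using 2 by (simp add: rank_diff_def q_subst_def)
  next
    case 3
    define s where "s = right_descent v"
    have s: "s \<in> S" "len (v \<otimes> s) < len v" using right_descent[OF 3] by (simp_all add: s_def)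
    have lens: "len v = Suc (len (v \<otimes> s))" "len u < len v"
      using len_mult_generator[OF v s(1)] s(2) bruhat_le_len[OF 3(1)] 3(2) by auto
    have cl: "u \<otimes> s \<in> carrier W" "v \<otimes> s \<in> carrier W" using u v s by auto
    have R: "R_poly u v = (if len (u \<otimes> s) < len u then R_poly (u \<otimes> s) (v \<otimes> s)
        else [:0, 1:] * R_poly (u \<otimes> s) (v \<otimes> s) + [:-1, 1:] * R_poly u (v \<otimes> s))"
      using 3 by (simp add: R_poly.simps[of u v] s_def)
    have rt: "R_tilde r u v = right_op s (\<lambda>w. R_tilde r w (v \<otimes> s)) u"
      by (rule R_tilde_right[OF r s(1) u v s(2)])
    have IH: "R_poly w (v \<otimes> s) = q_subst (rank_diff w (v \<otimes> s)) (R_tilde r w (v \<otimes> s))" if "w \<in> carrier W" for w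
      using less.hyps[OF s(2) that cl(2)] .
    show ?thesis
    proof (cases "len (u \<otimes> s) < len u")
      case True
      then have "rank_diff (u \<otimes> s) (v \<otimes> s) = rank_diff u v"
        using len_mult_generator[OF u s(1)] lens by (auto simp: rank_diff_def)
      then show ?thesis using True R rt IH[OF cl(1)] by (simp add: right_op_def)
    next
      case False
      then have us: "len (u \<otimes> s) = Suc (len u)" using len_mult_generator[OF u s(1)] by auto
      have rk: "rank_diff u v = Suc (rank_diff u (v \<otimes> s))" using lens by (simp add: rank_diff_def)
      have "[:0, 1:] * R_poly (u \<otimes> s) (v \<otimes> s) = q_subst (rank_diff u v) (R_tilde r (u \<otimes> s) (v \<otimes> s))"
      \<comment> \<open>Truncated subtraction gives the drop by 2 only if the lower element is not
        longer than the upper one; for incomparable elements both sides are 0.\<close>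
      proof (cases "bruhat_le (u \<otimes> s) (v \<otimes> s)")
        case True
        then have "len (u \<otimes> s) \<le> len (v \<otimes> s)" using bruhat_le_len by fastforce
        then have "rank_diff u v = Suc (Suc (rank_diff (u \<otimes> s) (v \<otimes> s)))"
          using us lens by (simp add: rank_diff_def)
        then show ?thesis
          using degree_R_tilde[OF r] IH[OF cl(1)] by (simp only: q_subst_Suc_Suc)
      next
        case False
        then show ?thesis by (simp add: R_tilde_eq_0 R_poly.simps[of "u \<otimes> s"])
      qed
      moreover have "[:-1, 1:] * R_poly u (v \<otimes> s) = q_subst (rank_diff u v) (q_var * R_tilde r u (v \<otimes> s))"
        unfolding rk q_var_def q_subst_Suc using IH[OF u] by simp
      ultimately show ?thesis
        using R rt us False by (simp only: right_op_def q_subst_add if_True if_False lessI)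
    qed
  qed
qed

theorem R_poly_dyer:
  assumes r: "reflection_order r" and "u \<in> carrier W" "v \<in> carrier W"
  shows "R_poly u v = (\<Sum>p\<in>bruhat_paths u v. if des r p = 0
    then monom 1 ((rank_diff u v - path_length p) div 2) * [:-1, 1:] ^ path_length p else 0)"
  unfolding R_poly_eq_R_tilde[OF assms] R_tilde_eq_sum[OF r] q_subst_sum
  by (rule sum.cong[OF refl]) (simp add: q_subst_monom bruhat_path_length(1))

section \<open>The Coxeter Chow function\<close>

lemma bruhat_paths_induct [consumes 1, case_names trivial snoc]:
  assumes "p \<in> bruhat_paths u v"
    and trivial: "u \<in> carrier W \<Longrightarrow> Q u [u]"
    and snoc: "\<And>v t p. \<lbrakk>v \<in> carrier W; t \<in> down v; p \<in> bruhat_paths u (v \<otimes> t); Q (v \<otimes> t) p\<rbrakk>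
      \<Longrightarrow> Q v (p @ [v])"
  shows "Q v p"
  using assms(1)
proof (induction "len v" arbitrary: v p rule: less_induct)
  case less
  then have v: "v \<in> carrier W" using bruhat_path_le bruhat_le_closed by blast
  from less.prems consider "u = v" "p = [v]"
    | t q where "t \<in> down v" "q \<in> bruhat_paths u (v \<otimes> t)" "p = q @ [v]"
    unfolding bruhat_paths_eq[OF v] by (auto split: if_splits)
  then show ?case
  proof cases
    case 1
    then show ?thesis using trivial v by simp
  next
    case 2
    then show ?thesis using snoc[OF v 2(1,2)] less.hyps[OF down_len[OF 2(1)] 2(2)] by simp
  qed
qed

lemma reflection_order_converse:
  assumes "reflection_order r"
  shows "reflection_order (r\<inverse>)"
proof -
  have "r\<inverse> \<subseteq> reflections \<times> reflections" "strict_linear_order_on reflections (r\<inverse>)"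
    using assms by (auto simp: reflection_order_def strict_linear_order_on_def irrefl_def)
  moreover have "\<forall>\<alpha>\<in>positive_roots. \<forall>\<beta>\<in>positive_roots. \<forall>l m :: real.
      \<alpha> \<noteq> \<beta> \<and> 0 < l \<and> 0 < m \<and> (\<lambda>t. l * \<alpha> t + m * \<beta> t) \<in> positive_roots \<longrightarrow>
      (let a = root_reflection \<alpha>; b = root_reflection \<beta>; c = root_reflection (\<lambda>t. l * \<alpha> t + m * \<beta> t)
       in (a, c) \<in> r\<inverse> \<and> (c, b) \<in> r\<inverse> \<or> (b, c) \<in> r\<inverse> \<and> (c, a) \<in> r\<inverse>)"
    using reflection_order_between[OF assms] unfolding Let_def by blast
  ultimately show ?thesis unfolding reflection_order_def by blast
qed

lemma des_le: "des r p \<le> path_length p - 1"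
proof -
  have "des r p \<le> card {1..<path_length p}" unfolding des_def by (intro card_mono) auto
  then show ?thesis by simp
qed

lemma asc_trivial [simp]: "asc r [v] = 0"
  by (simp add: asc_def)

lemma asc_snoc:
  assumes r: "reflection_order r" and "v \<in> carrier W" "t \<in> down v" "p \<in> bruhat_paths u (v \<otimes> t)"
  shows "asc r (p @ [v]) = asc r p + (if path_length p \<noteq> 0 \<and> (last_label p, t) \<in> r then 1 else 0)"
  using last_label_order[OF assms] des_le[of r p] bruhat_paths_nonempty[OF assms(4)]
  unfolding asc_def des_snoc[OF assms(2-4)] by (cases "path_length p = 0") auto

lemma asc_eq_des_converse:
  assumes r: "reflection_order r" and p: "p \<in> bruhat_paths u v"
  shows "asc r p = des (r\<inverse>) p"
  using p by (induction rule: bruhat_paths_induct) (simp_all add: asc_snoc[OF r] des_snoc)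

section \<open>Path weights and their recursions\<close>

definition half_defect :: "'a \<Rightarrow> 'a \<Rightarrow> 'a list \<Rightarrow> nat" where
  "half_defect u v p = (rank_diff u v - path_length p) div 2"

definition edge_weight :: "'a \<Rightarrow> 'a \<Rightarrow> int poly" where
  "edge_weight v t = monom 1 ((rank_diff (v \<otimes> t) v - 1) div 2)"

lemma half_defect_trivial [simp]: "half_defect v v [v] = 0"
  by (simp add: half_defect_def rank_diff_def)

text \<open>Rank difference minus length is additive along a path. It is even for the initial part,
  so the division by 2 splits too.\<close>

lemma monom_half_defect_snoc:
  assumes "t \<in> down v" "p \<in> bruhat_paths u (v \<otimes> t)"
  shows "monom 1 (half_defect u v (p @ [v])) = edge_weight v t * monom 1 (half_defect u (v \<otimes> t) p)"
proof -
  have "len u \<le> len (v \<otimes> t)" using bruhat_path_le[OF assms(2)] bruhat_le_len by fastforce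
  then have "rank_diff u v = rank_diff u (v \<otimes> t) + (rank_diff (v \<otimes> t) v - 1) + 1"
    using down_len[OF assms(1)] by (simp add: rank_diff_def)
  then have "rank_diff u v - path_length (p @ [v]) =
      (rank_diff (v \<otimes> t) v - 1) + (rank_diff u (v \<otimes> t) - path_length p)"
    using bruhat_path_length(1)[OF assms(2)] bruhat_paths_nonempty[OF assms(2)] by simp
  moreover obtain k where "rank_diff u (v \<otimes> t) - path_length p = 2 * k"
    using bruhat_path_length(2)[OF assms(2)] by blast
  ultimately have "half_defect u v (p @ [v]) = (rank_diff (v \<otimes> t) v - 1) div 2 + half_defect u (v \<otimes> t) p"
    by (simp add: half_defect_def)
  then show ?thesis by (simp add: edge_weight_def mult_monom)
qed

definition chow_sum :: "('a \<times> 'a) set \<Rightarrow> 'a \<Rightarrow> 'a \<Rightarrow> int poly" where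
  "chow_sum r u v = (\<Sum>p\<in>bruhat_paths u v. monom 1 (half_defect u v p + asc r p))"

text \<open>The contribution of the paths ending with an edge labelled t. The label has to be
  recorded, as it decides whether the next vertex is an ascent.\<close>

definition chow_last :: "('a \<times> 'a) set \<Rightarrow> 'a \<Rightarrow> 'a \<Rightarrow> 'a \<Rightarrow> int poly" where
  "chow_last r u v t = (\<Sum>p\<in>bruhat_paths u (v \<otimes> t). monom 1 (half_defect u v (p @ [v]) + asc r (p @ [v])))"

text \<open>The exponent of x - 1 is the length of p and not of \<open>p @ [v]\<close>, since
  \<open>R_bar\<close> has one factor x - 1 divided out.\<close>

definition incr_last :: "('a \<times> 'a) set \<Rightarrow> 'a \<Rightarrow> 'a \<Rightarrow> 'a \<Rightarrow> int poly" where
  "incr_last r u v t = (\<Sum>p\<in>bruhat_paths u (v \<otimes> t). if des r (p @ [v]) = 0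
    then monom 1 (half_defect u v (p @ [v])) * [:-1, 1:] ^ path_length p else 0)"

lemma chow_sum_eq:
  assumes "v \<in> carrier W"
  shows "chow_sum r u v = (if u = v then 1 else 0) + (\<Sum>t\<in>down v. chow_last r u v t)"
  unfolding chow_sum_def chow_last_def sum_bruhat_paths[OF assms] by simp

lemma chow_last_rec:
  assumes r: "reflection_order r" and v: "v \<in> carrier W" and t: "t \<in> down v"
  shows "chow_last r u v t = edge_weight v t * ((if u = v \<otimes> t then 1 else 0) +
    (\<Sum>t'\<in>down (v \<otimes> t). (if (t', t) \<in> r then [:0, 1:] else 1) * chow_last r u (v \<otimes> t) t'))"
proof -
  have vt: "v \<otimes> t \<in> carrier W" using v down_reflections[OF t] by auto
  let ?f = "\<lambda>p. (if path_length p \<noteq> 0 \<and> (last_label p, t) \<in> r then [:0, 1:] else 1) *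
      monom 1 (half_defect u (v \<otimes> t) p + asc r p) :: int poly"
  have "monom 1 (half_defect u v (p @ [v]) + asc r (p @ [v])) = edge_weight v t * ?f p"
    if "p \<in> bruhat_paths u (v \<otimes> t)" for p
  proof -
    have "monom 1 (half_defect u v (p @ [v]) + asc r (p @ [v])) =
        edge_weight v t * monom 1 (half_defect u (v \<otimes> t) p) * (monom 1 (asc r (p @ [v])) :: int poly)"
      unfolding monom_half_defect_snoc[OF t that, symmetric] by (simp add: mult_monom)
    moreover have "monom 1 (asc r (p @ [v])) =
        (if path_length p \<noteq> 0 \<and> (last_label p, t) \<in> r then [:0, 1:] else 1) * (monom 1 (asc r p) :: int poly)"
      by (simp add: asc_snoc[OF r v t that] monom_Suc)
    moreover have "monom 1 (half_defect u (v \<otimes> t) p + asc r p) =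
        monom 1 (half_defect u (v \<otimes> t) p) * (monom 1 (asc r p) :: int poly)" by (simp add: mult_monom)
    ultimately show ?thesis by (simp only: mult_ac)
  qed
  then have "chow_last r u v t = edge_weight v t * (\<Sum>p\<in>bruhat_paths u (v \<otimes> t). ?f p)"
    by (simp add: chow_last_def sum_distrib_left)
  also have "(\<Sum>p\<in>bruhat_paths u (v \<otimes> t). ?f p) = (if u = v \<otimes> t then 1 else 0) +
      (\<Sum>t'\<in>down (v \<otimes> t). \<Sum>p\<in>bruhat_paths u (v \<otimes> t \<otimes> t'). ?f (p @ [v \<otimes> t]))"
    unfolding sum_bruhat_paths[OF vt] by simp
  also have "(\<Sum>t'\<in>down (v \<otimes> t). \<Sum>p\<in>bruhat_paths u (v \<otimes> t \<otimes> t'). ?f (p @ [v \<otimes> t])) =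
      (\<Sum>t'\<in>down (v \<otimes> t). (if (t', t) \<in> r then [:0, 1:] else 1) * chow_last r u (v \<otimes> t) t')"
  proof (rule sum.cong[OF refl])
    fix t'
    assume t': "t' \<in> down (v \<otimes> t)"
    show "(\<Sum>p\<in>bruhat_paths u (v \<otimes> t \<otimes> t'). ?f (p @ [v \<otimes> t])) =
      (if (t', t) \<in> r then [:0, 1:] else 1) * chow_last r u (v \<otimes> t) t'"
      unfolding chow_last_def sum_distrib_left
      by (rule sum.cong[OF refl])
        (use bruhat_paths_nonempty in \<open>simp add: last_label_snoc[OF vt t']\<close>)
  qed
  finally show ?thesis .
qed

lemma incr_last_rec:
  assumes r: "reflection_order r" and v: "v \<in> carrier W" and t: "t \<in> down v"
  shows "incr_last r u v t = edge_weight v t * ((if u = v \<otimes> t then 1 else 0) +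
    (\<Sum>t'\<in>down (v \<otimes> t). if (t', t) \<in> r then [:-1, 1:] * incr_last r u (v \<otimes> t) t' else 0))"
proof -
  have vt: "v \<otimes> t \<in> carrier W" using v down_reflections[OF t] by auto
  let ?f = "\<lambda>p. if des r p = 0 \<and> (path_length p = 0 \<or> (last_label p, t) \<in> r)
      then monom 1 (half_defect u (v \<otimes> t) p) * [:-1, 1:] ^ path_length p else (0 :: int poly)"
  have "(if des r (p @ [v]) = 0 then monom 1 (half_defect u v (p @ [v])) * [:-1, 1:] ^ path_length p else 0) =
      edge_weight v t * ?f p" if "p \<in> bruhat_paths u (v \<otimes> t)" for p
    using last_label_order[OF r v t that]
    by (auto simp: monom_half_defect_snoc[OF t that] des_snoc[OF v t that] mult.assoc)
  then have "incr_last r u v t = edge_weight v t * (\<Sum>p\<in>bruhat_paths u (v \<otimes> t). ?f p)"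
    unfolding incr_last_def sum_distrib_left by (rule sum.cong[OF refl])
  also have "(\<Sum>p\<in>bruhat_paths u (v \<otimes> t). ?f p) = (if u = v \<otimes> t then 1 else 0) +
      (\<Sum>t'\<in>down (v \<otimes> t). \<Sum>p\<in>bruhat_paths u (v \<otimes> t \<otimes> t'). ?f (p @ [v \<otimes> t]))"
    unfolding sum_bruhat_paths[OF vt] by simp
  also have "(\<Sum>t'\<in>down (v \<otimes> t). \<Sum>p\<in>bruhat_paths u (v \<otimes> t \<otimes> t'). ?f (p @ [v \<otimes> t])) =
      (\<Sum>t'\<in>down (v \<otimes> t). if (t', t) \<in> r then [:-1, 1:] * incr_last r u (v \<otimes> t) t' else 0)"
  proof (rule sum.cong[OF refl])
    fix t'
    assume t': "t' \<in> down (v \<otimes> t)"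
    have "?f (p @ [v \<otimes> t]) = (if (t', t) \<in> r then [:-1, 1:] * (if des r (p @ [v \<otimes> t]) = 0
        then monom 1 (half_defect u (v \<otimes> t) (p @ [v \<otimes> t])) * [:-1, 1:] ^ path_length p else 0) else 0)"
      if "p \<in> bruhat_paths u (v \<otimes> t \<otimes> t')" for p
      using bruhat_paths_nonempty[OF that]
      by (simp add: last_label_snoc[OF vt t' that] mult.left_commute del: mult_pCons_left mult_pCons_right)
    then show "(\<Sum>p\<in>bruhat_paths u (v \<otimes> t \<otimes> t'). ?f (p @ [v \<otimes> t])) =
      (if (t', t) \<in> r then [:-1, 1:] * incr_last r u (v \<otimes> t) t' else 0)"
      unfolding incr_last_def by (simp add: sum_distrib_left del: mult_pCons_left mult_pCons_right)
  qed
  finally show ?thesis .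
qed

text \<open>For distinct u and v every path has a last edge, so each term of Dyer's formula is
  visibly divisible by x - 1 and the polynomial division is exact.\<close>

lemma R_bar_eq:
  assumes r: "reflection_order r" and "bruhat_le u v" "u \<noteq> v"
  shows "R_bar u v = (\<Sum>t\<in>down v. incr_last r u v t)"
proof -
  have uv: "u \<in> carrier W" "v \<in> carrier W" using assms bruhat_le_closed by auto
  have "R_poly u v = (\<Sum>t\<in>down v. \<Sum>p\<in>bruhat_paths u (v \<otimes> t). if des r (p @ [v]) = 0
      then monom 1 (half_defect u v (p @ [v])) * [:-1, 1:] ^ path_length (p @ [v]) else 0)"
    unfolding R_poly_dyer[OF r uv] sum_bruhat_paths[OF uv(2)] half_defect_def using assms by simp
  also have "\<dots> = [:-1, 1:] * (\<Sum>t\<in>down v. incr_last r u v t)"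
    unfolding incr_last_def sum_distrib_left
    by (intro sum.cong[OF refl])
      (use bruhat_paths_nonempty in \<open>simp add: mult.left_commute del: mult_pCons_left mult_pCons_right\<close>)
  finally have "R_poly u v div [:-1, 1:] = (\<Sum>t\<in>down v. incr_last r u v t)"
    by (simp only: nonzero_mult_div_cancel_left pCons_eq_0_iff one_neq_zero simp_thms not_False_eq_True)
  then show ?thesis using assms by (simp add: R_bar_def bruhat_less_def)
qed

lemma bruhat_le_trans: "bruhat_le u v \<Longrightarrow> bruhat_le v w \<Longrightarrow> bruhat_le u w"
  by (auto simp: bruhat_le_def)

lemma bruhat_le_refl [simp]: "u \<in> carrier W \<Longrightarrow> bruhat_le u u"
  by (simp add: bruhat_le_def)

lemma bruhat_le_antisym: "bruhat_le u v \<Longrightarrow> bruhat_le v u \<Longrightarrow> u = v"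
  using bruhat_le_len[of u v] bruhat_le_len[of v u] by auto

lemma bruhat_le_down: "v \<in> carrier W \<Longrightarrow> t \<in> down v \<Longrightarrow> bruhat_le (v \<otimes> t) v"
  using bruhat_edge_iff[of v "v \<otimes> t"] by (auto simp: bruhat_le_def bruhat_edge_def)

lemma finite_bruhat_below: "finite {w. bruhat_le w v}"
proof (cases "v \<in> carrier W")
  case True
  then show ?thesis
  proof (induction "len v" arbitrary: v rule: less_induct)
    case less
    have "{w. bruhat_le w v} \<subseteq> insert v (\<Union>t\<in>down v. {w. bruhat_le w (v \<otimes> t)})"
    proof
      fix w
      assume "w \<in> {w. bruhat_le w v}"
      then have w: "w \<in> carrier W" "bruhat_edge\<^sup>*\<^sup>* w v" by (auto simp: bruhat_le_def)
      from w(2) show "w \<in> insert v (\<Union>t\<in>down v. {w. bruhat_le w (v \<otimes> t)})"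
      proof (cases rule: rtranclp.cases)
        case (rtrancl_into_rtrancl b)
        then obtain t where "t \<in> down v" "b = v \<otimes> t" using bruhat_edge_iff[OF less.prems] by blast
        then show ?thesis using rtrancl_into_rtrancl w by (auto simp: bruhat_le_def)
      qed simp
    qed
    moreover have "finite {w. bruhat_le w (v \<otimes> t)}" if "t \<in> down v" for t
      using less that by (auto simp: down_def)
    ultimately show ?case
      using less.prems by (meson finite.insertI finite_UN_I finite_down finite_subset)
  qed
next
  case False
  then have "{w. bruhat_le w v} = {}" using bruhat_le_closed by blast
  then show ?thesis by simp
qed

lemma finite_interval [simp, intro]: "finite {w. bruhat_le u w \<and> bruhat_le w v}"
  using finite_bruhat_below[of v] by (rule rev_finite_subset) auto

lemma chow_sum_eq_0: "\<not> bruhat_le u v \<Longrightarrow> chow_sum r u v = 0"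
  using bruhat_path_le by (force simp: chow_sum_def intro: sum.neutral)

text \<open>
  Cutting a path at any vertex behind which it is increasing, and giving the increasing part the
  weight \<open>(x - 1)\<^bsup>k - 1\<^esup>\<close> where \<open>k\<close> is its length: the sum over all cuts telescopes to
  \<open>x\<close> to the number of ascents.
\<close>

lemma chow_last_convolution:
  assumes r: "reflection_order r" and "v \<in> carrier W" "t \<in> down v"
    and "finite I" "{w. bruhat_le u w \<and> bruhat_le w v} \<subseteq> I"
  shows "(\<Sum>w\<in>I. chow_sum r u w * incr_last r w v t) = chow_last r u v t"
  using assms(2,3,5)
proof (induction "len v" arbitrary: v t rule: less_induct)
  case less
  note v = less.prems(1) and t = less.prems(2)
  have vt: "v \<otimes> t \<in> carrier W" using v down_reflections[OF t] by auto
  let ?x = "[:-1, 1:] :: int poly"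
  have sub: "{w. bruhat_le u w \<and> bruhat_le w (v \<otimes> t)} \<subseteq> I"
    using less.prems(3) bruhat_le_down[OF v t] bruhat_le_trans by blast
  have IH: "(\<Sum>w\<in>I. chow_sum r u w * incr_last r w (v \<otimes> t) t') = chow_last r u (v \<otimes> t) t'"
    if "t' \<in> down (v \<otimes> t)" for t'
    using less.hyps[OF down_len[OF t] vt that sub] .
  have "(\<Sum>w\<in>I. chow_sum r u w * incr_last r w v t) = edge_weight v t *
      ((\<Sum>w\<in>I. if w = v \<otimes> t then chow_sum r u w else 0) +
       (\<Sum>w\<in>I. \<Sum>t'\<in>down (v \<otimes> t). if (t', t) \<in> r then ?x * (chow_sum r u w * incr_last r w (v \<otimes> t) t') else 0))"
  proof -
    have "chow_sum r u w * incr_last r w v t = edge_weight v t *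
        ((if w = v \<otimes> t then chow_sum r u w else 0) +
         (\<Sum>t'\<in>down (v \<otimes> t). if (t', t) \<in> r then ?x * (chow_sum r u w * incr_last r w (v \<otimes> t) t') else 0))" for w
    proof -
      have "(\<Sum>t'\<in>down (v \<otimes> t). if (t', t) \<in> r then ?x * (chow_sum r u w * incr_last r w (v \<otimes> t) t') else 0)
        = chow_sum r u w * (\<Sum>t'\<in>down (v \<otimes> t). if (t', t) \<in> r then ?x * incr_last r w (v \<otimes> t) t' else 0)"
        unfolding sum_distrib_left
        by (rule sum.cong[OF refl]) (simp add: mult.left_commute del: mult_pCons_left mult_pCons_right)
      then show ?thesis
        unfolding incr_last_rec[OF r v t] by (simp add: algebra_simps del: mult_pCons_left mult_pCons_right)
    qed
    then show ?thesis by (simp only: sum_distrib_left[symmetric] sum.distrib)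
  qed
  \<comment> \<open>The cut just before the last edge, which is then an increasing piece by itself.
    The other sum extends the final piece across \<open>v \<otimes> t\<close>, which is possible at
    an ascent only.\<close>
  also have "(\<Sum>w\<in>I. if w = v \<otimes> t then chow_sum r u w else 0) = chow_sum r u (v \<otimes> t)"
  proof (cases "bruhat_le u (v \<otimes> t)")
    case True
    then have "v \<otimes> t \<in> I" using sub vt by auto
    then show ?thesis using \<open>finite I\<close> by simp
  next
    case False
    then show ?thesis by (auto simp: chow_sum_eq_0 intro!: sum.neutral)
  qed
  also have "(\<Sum>w\<in>I. \<Sum>t'\<in>down (v \<otimes> t). if (t', t) \<in> r then ?x * (chow_sum r u w * incr_last r w (v \<otimes> t) t') else 0) =
      (\<Sum>t'\<in>down (v \<otimes> t). if (t', t) \<in> r then ?x * chow_last r u (v \<otimes> t) t' else 0)"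
    by (subst sum.swap, rule sum.cong[OF refl])
      (simp add: sum_distrib_left[symmetric] IH del: mult_pCons_left mult_pCons_right)
  also have "chow_sum r u (v \<otimes> t) = (if u = v \<otimes> t then 1 else 0) + (\<Sum>t'\<in>down (v \<otimes> t). chow_last r u (v \<otimes> t) t')"
    by (rule chow_sum_eq[OF vt])
  also have "edge_weight v t * ((if u = v \<otimes> t then 1 else 0) + (\<Sum>t'\<in>down (v \<otimes> t). chow_last r u (v \<otimes> t) t')
      + (\<Sum>t'\<in>down (v \<otimes> t). if (t', t) \<in> r then ?x * chow_last r u (v \<otimes> t) t' else 0)) = chow_last r u v t"
  proof -
    have "[:0, 1:] = 1 + ?x" by (simp add: one_pCons)
    then have "(if (t', t) \<in> r then [:0, 1:] else 1) * c = c + (if (t', t) \<in> r then ?x * c else 0)" for t' c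
      by (simp add: distrib_right del: mult_pCons_left mult_pCons_right)
    then show ?thesis
      unfolding chow_last_rec[OF r v t] by (simp only: sum.distrib add.assoc)
  qed
  finally show ?case .
qed

text \<open>The diagonal value -1 of \<open>R_bar\<close> makes it the sum of the
  \<open>incr_last\<close> minus the identity. The convolution then collects all paths with a last
  edge and subtracts all paths, leaving only the trivial one.\<close>

lemma chow_sum_R_bar:
  assumes r: "reflection_order r" and uv: "bruhat_le u v"
  shows "(\<Sum>w | bruhat_le u w \<and> bruhat_le w v. chow_sum r u w * R_bar w v) = (if u = v then - 1 else 0)"
proof -
  let ?I = "{w. bruhat_le u w \<and> bruhat_le w v}"
  have c: "u \<in> carrier W" "v \<in> carrier W" using uv bruhat_le_closed by auto
  have vI: "v \<in> ?I" using uv c by simp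
  have "incr_last r v v t = 0" if "t \<in> down v" for t
  proof -
    have "bruhat_paths v (v \<otimes> t) = {}"
      using bruhat_path_le bruhat_le_len down_len[OF that] by fastforce
    then show ?thesis by (simp add: incr_last_def)
  qed
  then have R: "R_bar w v = (\<Sum>t\<in>down v. incr_last r w v t) - (if w = v then 1 else 0)"
    if "w \<in> ?I" for w
    using that c R_bar_eq[OF r, of w v] by (cases "w = v") (auto simp: R_bar_def bruhat_less_def)
  have "(\<Sum>w\<in>?I. chow_sum r u w * R_bar w v) =
      (\<Sum>w\<in>?I. (\<Sum>t\<in>down v. chow_sum r u w * incr_last r w v t) - (if w = v then chow_sum r u w else 0))"
    by (rule sum.cong[OF refl]) (simp add: R sum_distrib_left right_diff_distrib)
  also have "\<dots> = (\<Sum>t\<in>down v. \<Sum>w\<in>?I. chow_sum r u w * incr_last r w v t) - chow_sum r u v"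
    using vI by (simp add: sum_subtractf sum.swap[of _ ?I])
  also have "\<dots> = (\<Sum>t\<in>down v. chow_last r u v t) - chow_sum r u v"
    using chow_last_convolution[OF r c(2)] by simp
  also have "\<dots> = (if u = v then - 1 else 0)" using chow_sum_eq[OF c(2), of r u] by simp
  finally show ?thesis .
qed

section \<open>Inverses in the incidence algebra\<close>

lemma incidence_mult:
  assumes "a \<in> carrier incidence_algebra" "b \<in> carrier incidence_algebra"
    and "finite I" "{w. bruhat_le u w \<and> bruhat_le w v} \<subseteq> I"
  shows "(a \<otimes>\<^bsub>incidence_algebra\<^esub> b) u v = (\<Sum>w\<in>I. a u w * b w v)"
proof -
  have "(\<Sum>w\<in>I. a u w * b w v) = (\<Sum>w | bruhat_le u w \<and> bruhat_le w v. a u w * b w v)"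
    using assms by (intro sum.mono_neutral_right) (auto simp: incidence_algebra_def)
  then show ?thesis by (simp add: incidence_algebra_def)
qed

lemma incidence_mult_closed:
  assumes "a \<in> carrier incidence_algebra" "b \<in> carrier incidence_algebra"
  shows "a \<otimes>\<^bsub>incidence_algebra\<^esub> b \<in> carrier incidence_algebra"
proof -
  have "{w. bruhat_le u w \<and> bruhat_le w v} = {}" if "\<not> bruhat_le u v" for u v
    using that bruhat_le_trans by blast
  then show ?thesis by (auto simp: incidence_algebra_def simp del: Collect_empty_eq)
qed

lemma incidence_carrier: "a \<in> carrier incidence_algebra \<longleftrightarrow> (\<forall>u v. \<not> bruhat_le u v \<longrightarrow> a u v = 0)"
  and incidence_one: "\<one>\<^bsub>incidence_algebra\<^esub> = (\<lambda>u v. if bruhat_le u v \<and> u = v then 1 else 0)"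
  by (simp_all add: incidence_algebra_def)

text \<open>Uniqueness of inverses comes from the monoid structure. For associativity, inner and
  outer sums are extended to one common interval, where the additional terms vanish.\<close>

lemma incidence_monoid: "monoid incidence_algebra"
proof (rule monoidI)
  fix a b c
  assume abc: "a \<in> carrier incidence_algebra" "b \<in> carrier incidence_algebra" "c \<in> carrier incidence_algebra"
  show "a \<otimes>\<^bsub>incidence_algebra\<^esub> b \<otimes>\<^bsub>incidence_algebra\<^esub> c = a \<otimes>\<^bsub>incidence_algebra\<^esub> (b \<otimes>\<^bsub>incidence_algebra\<^esub> c)"
  proof (intro ext)
    fix u v
    let ?I = "{w. bruhat_le u w \<and> bruhat_le w v}"
    have sub: "{z. bruhat_le u z \<and> bruhat_le z w} \<subseteq> ?I" "{z. bruhat_le w z \<and> bruhat_le z v} \<subseteq> ?I"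
      if "w \<in> ?I" for w
      using that bruhat_le_trans by blast+
    have "(a \<otimes>\<^bsub>incidence_algebra\<^esub> b \<otimes>\<^bsub>incidence_algebra\<^esub> c) u v = (\<Sum>w\<in>?I. (\<Sum>z\<in>?I. a u z * b z w) * c w v)"
      using abc incidence_mult_closed sub
      by (subst incidence_mult[where I = ?I]) (auto intro!: sum.cong simp: incidence_mult[where I = ?I])
    also have "\<dots> = (\<Sum>z\<in>?I. a u z * (\<Sum>w\<in>?I. b z w * c w v))"
      unfolding sum_distrib_left sum_distrib_right by (subst sum.swap) (simp add: mult.assoc)
    also have "\<dots> = (a \<otimes>\<^bsub>incidence_algebra\<^esub> (b \<otimes>\<^bsub>incidence_algebra\<^esub> c)) u v"
      using abc incidence_mult_closed sub
      by (subst incidence_mult[where I = ?I]) (auto intro!: sum.cong simp: incidence_mult[where I = ?I])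
    finally show "(a \<otimes>\<^bsub>incidence_algebra\<^esub> b \<otimes>\<^bsub>incidence_algebra\<^esub> c) u v =
      (a \<otimes>\<^bsub>incidence_algebra\<^esub> (b \<otimes>\<^bsub>incidence_algebra\<^esub> c)) u v" .
  qed
next
  fix a
  assume a: "a \<in> carrier incidence_algebra"
  have one: "\<one>\<^bsub>incidence_algebra\<^esub> \<in> carrier incidence_algebra" by (simp add: incidence_carrier incidence_one)
  show "\<one>\<^bsub>incidence_algebra\<^esub> \<otimes>\<^bsub>incidence_algebra\<^esub> a = a"
  proof (intro ext)
    fix u v
    show "(\<one>\<^bsub>incidence_algebra\<^esub> \<otimes>\<^bsub>incidence_algebra\<^esub> a) u v = a u v"
    proof (cases "bruhat_le u v")
      case True
      have "(\<one>\<^bsub>incidence_algebra\<^esub> \<otimes>\<^bsub>incidence_algebra\<^esub> a) u v =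
          (\<Sum>w | bruhat_le u w \<and> bruhat_le w v. if u = w then a w v else 0)"
        by (subst incidence_mult[OF one a finite_interval order_refl], intro sum.cong refl)
          (auto simp: incidence_one)
      also have "\<dots> = a u v" using True bruhat_le_closed[OF True] by simp
      finally show ?thesis .
    next
      case False
      then show ?thesis using a incidence_mult_closed[OF one a] by (simp add: incidence_carrier)
    qed
  qed
  show "a \<otimes>\<^bsub>incidence_algebra\<^esub> \<one>\<^bsub>incidence_algebra\<^esub> = a"
  proof (intro ext)
    fix u v
    show "(a \<otimes>\<^bsub>incidence_algebra\<^esub> \<one>\<^bsub>incidence_algebra\<^esub>) u v = a u v"
    proof (cases "bruhat_le u v")
      case True
      have "(a \<otimes>\<^bsub>incidence_algebra\<^esub> \<one>\<^bsub>incidence_algebra\<^esub>) u v =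
          (\<Sum>w | bruhat_le u w \<and> bruhat_le w v. if w = v then a u w else 0)"
        by (subst incidence_mult[OF a one finite_interval order_refl], intro sum.cong refl)
          (auto simp: incidence_one)
      also have "\<dots> = a u v" using True bruhat_le_closed[OF True] by simp
      finally show ?thesis .
    next
      case False
      then show ?thesis using a incidence_mult_closed[OF a one] by (simp add: incidence_carrier)
    qed
  qed
qed (auto simp: incidence_mult_closed, simp add: incidence_carrier incidence_one)

text \<open>Solves b a = 1 for the last unknown \<open>b u v\<close> in terms of shorter end points,
  for a with diagonal -1: on the diagonal (-1)(-1) = 1, and otherwise the term
  \<open>b u v * a v v\<close> is minus the unknown.\<close>

function incidence_left_inv :: "('a \<Rightarrow> 'a \<Rightarrow> int poly) \<Rightarrow> 'a \<Rightarrow> 'a \<Rightarrow> int poly" where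
  "incidence_left_inv a u v = (if \<not> bruhat_le u v then 0 else if u = v then - 1
    else \<Sum>w\<in>{w. bruhat_le u w \<and> bruhat_le w v} - {v}. incidence_left_inv a u w * a w v)"
  by auto
termination
  by (relation "measure (\<lambda>(a, u, v). len v)") (auto dest: bruhat_le_len)

declare incidence_left_inv.simps [simp del]

lemma incidence_left_inv:
  assumes a: "a \<in> carrier incidence_algebra" and diag: "\<And>u. u \<in> carrier W \<Longrightarrow> a u u = - 1"
  shows "incidence_left_inv a \<in> carrier incidence_algebra"
    and "incidence_left_inv a \<otimes>\<^bsub>incidence_algebra\<^esub> a = \<one>\<^bsub>incidence_algebra\<^esub>"
proof -
  let ?b = "incidence_left_inv a"
  show b: "?b \<in> carrier incidence_algebra" by (simp add: incidence_carrier incidence_left_inv.simps)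
  show "?b \<otimes>\<^bsub>incidence_algebra\<^esub> a = \<one>\<^bsub>incidence_algebra\<^esub>"
  proof (intro ext)
    fix u v
    show "(?b \<otimes>\<^bsub>incidence_algebra\<^esub> a) u v = \<one>\<^bsub>incidence_algebra\<^esub> u v"
    proof (cases "bruhat_le u v")
      case True
      let ?I = "{w. bruhat_le u w \<and> bruhat_le w v}"
      have c: "u \<in> carrier W" "v \<in> carrier W" using True bruhat_le_closed by auto
      have "(?b \<otimes>\<^bsub>incidence_algebra\<^esub> a) u v = (\<Sum>w\<in>?I. ?b u w * a w v)"
        by (rule incidence_mult[OF b a finite_interval order_refl])
      also have "\<dots> = ?b u v * a v v + (\<Sum>w\<in>?I - {v}. ?b u w * a w v)"
        using True c by (subst sum.remove[of _ v]) auto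
      also have "\<dots> = (if u = v then 1 else 0)"
      proof (cases "u = v")
        case True
        then have "?I = {v}" using c bruhat_le_antisym by auto
        then show ?thesis using True c diag by (simp add: incidence_left_inv.simps[of a v v])
      next
        case False
        then show ?thesis using True c diag by (simp add: incidence_left_inv.simps[of a u v])
      qed
      finally show ?thesis using True by (simp add: incidence_one)
    next
      case False
      then have "(?b \<otimes>\<^bsub>incidence_algebra\<^esub> a) u v = 0"
        using incidence_mult_closed[OF b a] unfolding incidence_carrier by blast
      then show ?thesis using False by (simp add: incidence_one)
    qed
  qed
qed

text \<open>The additive inverse unfolds to a definite description over the additive structure;
  existence and uniqueness are checked pointwise.\<close>

lemma incidence_uminus:
  assumes "a \<in> carrier incidence_algebra"
  shows "\<ominus>\<^bsub>incidence_algebra\<^esub> a = (\<lambda>u v. - a u v)"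
proof -
  have "(THE b. b \<in> carrier incidence_algebra \<and> (\<lambda>u v. a u v + b u v) = (\<lambda>u v. 0) \<and>
      (\<lambda>u v. b u v + a u v) = (\<lambda>u v. 0)) = (\<lambda>u v. - a u v)"
  proof (rule the_equality)
    fix b
    assume "b \<in> carrier incidence_algebra \<and> (\<lambda>u v. a u v + b u v) = (\<lambda>u v. 0) \<and>
      (\<lambda>u v. b u v + a u v) = (\<lambda>u v. 0)"
    then have "a u v + b u v = 0" for u v by metis
    then show "b = (\<lambda>u v. - a u v)" by (simp add: fun_eq_iff eq_neg_iff_add_eq_0 add.commute)
  qed (use assms in \<open>simp add: incidence_carrier\<close>)
  then show ?thesis by (simp add: a_inv_def m_inv_def incidence_algebra_def)
qed

theorem coxeter_chow_eq_chow_sum: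
  assumes r: "reflection_order r"
  shows "coxeter_chow = chow_sum r"
proof -
  let ?D = "\<lambda>u v. - chow_sum r u v"
  interpret I: monoid incidence_algebra by (rule incidence_monoid)
  have D: "?D \<in> carrier incidence_algebra" by (simp add: incidence_carrier chow_sum_eq_0)
  have R: "R_bar \<in> carrier incidence_algebra" by (simp add: incidence_carrier R_bar_def bruhat_less_def)
  have DR: "?D \<otimes>\<^bsub>incidence_algebra\<^esub> R_bar = \<one>\<^bsub>incidence_algebra\<^esub>"
  proof (intro ext)
    fix u v
    show "(?D \<otimes>\<^bsub>incidence_algebra\<^esub> R_bar) u v = \<one>\<^bsub>incidence_algebra\<^esub> u v"
    proof (cases "bruhat_le u v")
      case True
      then show ?thesis
        using chow_sum_R_bar[OF r True] incidence_mult[OF D R finite_interval order_refl, of u v]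
        by (simp add: incidence_one sum_negf)
    next
      case False
      then have "(?D \<otimes>\<^bsub>incidence_algebra\<^esub> R_bar) u v = 0"
        using incidence_mult_closed[OF D R] unfolding incidence_carrier by blast
      then show ?thesis using False by (simp add: incidence_one)
    qed
  qed
  have L: "incidence_left_inv ?D \<in> carrier incidence_algebra"
      "incidence_left_inv ?D \<otimes>\<^bsub>incidence_algebra\<^esub> ?D = \<one>\<^bsub>incidence_algebra\<^esub>"
    by (rule incidence_left_inv[OF D], simp add: chow_sum_def bruhat_paths_self)+
  \<comment> \<open>\<open>?D\<close> has a left inverse by triangularity and the right inverse
    \<open>R_bar\<close>; these coincide, so \<open>R_bar\<close> is inverse to \<open>?D\<close> on
    both sides.\<close>
  have "incidence_left_inv ?D = R_bar"
    using I.inv_unique[OF L(2) DR D L(1) R] .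
  then have "R_bar \<otimes>\<^bsub>incidence_algebra\<^esub> ?D = \<one>\<^bsub>incidence_algebra\<^esub>" using L(2) by simp
  then have "inv\<^bsub>incidence_algebra\<^esub> R_bar = ?D" using I.inv_unique'[OF R D] DR by simp
  then show ?thesis unfolding coxeter_chow_def using incidence_uminus[OF D] by simp
qed

end

theorem theorem6p5:
  fixes W :: "('a, 'b) monoid_scheme" and S :: "'a set" and r :: "('a \<times> 'a) set" and u v :: 'a
  assumes "coxeter_system W S"
    and "coxeter_system.reflection_order W S r"
    and "coxeter_system.bruhat_less W S u v"
  shows "coxeter_system.coxeter_chow W S u v =
      (\<Sum>p \<in> coxeter_system.bruhat_paths W S u v.
        monom 1 ((coxeter_system.rank_diff W S u v - coxeter_system.path_length p) div 2
          + coxeter_system.asc W r p))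
    \<and> coxeter_system.coxeter_chow W S u v =
      (\<Sum>p \<in> coxeter_system.bruhat_paths W S u v.
        monom 1 ((coxeter_system.rank_diff W S u v - coxeter_system.path_length p) div 2
          + coxeter_system.des W r p))"
proof -
  interpret coxeter_system W S by fact
  note r = assms(2)
  note r' = reflection_order_converse[OF r]
  have "coxeter_chow u v =
      (\<Sum>p\<in>bruhat_paths u v. monom 1 ((rank_diff u v - path_length p) div 2 + asc r p))"
    unfolding coxeter_chow_eq_chow_sum[OF r] chow_sum_def half_defect_def ..
  moreover have "coxeter_chow u v =
      (\<Sum>p\<in>bruhat_paths u v. monom 1 ((rank_diff u v - path_length p) div 2 + des r p))"
    unfolding coxeter_chow_eq_chow_sum[OF r'] chow_sum_def half_defect_def
    by (rule sum.cong[OF refl]) (simp add: asc_eq_des_converse[OF r'])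
  ultimately show ?thesis by blast
qed

end
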